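(* The optimization problems associated to EDGE-IDCODE in general graphs and to IDCODE restricted to line graphs are $4$-approximable in polynomial time. That is: (1) there is a polynomial-time algorithm which, given a pendant-free graph $G$, outputs an edge-identifying code of $G$ of size at most $4\,\gamma^{\mathrm{EID}}(G)$; (2) there is a polynomial-time algorithm which, given a twin-free line graph $H$, outputs an identifying code of $H$ of size at most $4\,\gamma^{\mathrm{ID}}(H)$.
   Context: Graphs are finite and simple; in (1) graphs have nonempty edge set. The line graph $\mathcal{L}(G)$ of a simple graph $G$ has vertex set $E(G)$, two vertices being adjacent if the corresponding edges share an endpoint; a line graph is a graph isomorphic to some $\mathcal{L}(G)$. An identifying code of a graph $H$ is a set $\mathcal{C}\subseteq V(H)$ such that $N[v]\cap\mathcal{C}\neq\emptyset$ for every vertex $v$ and $N[u]\cap\mathcal{C}\neq N[v]\cap\mathcal{C}$ for all distinct vertices $u,v$, where $N[v]$ is the closed neighbourhood. $H$ is twin-free if $N[x]\neq N[y]$ for all distinct vertices $x,y$ (equivalently $H$ has an identifying code), and then $\gamma^{\mathrm{ID}}(H)$ is the minimum size of an identifying code. For an edge $e$ of $G$, $N[e]$ is the set consisting of $e$ and all edges sharing an endpoint with $e$. A set $\mathcal{C}_E\subseteq E(G)$ is an edge-identifying code of $G$ if $N[e]\cap\mathcal{C}_E\neq\emptyset$ for every $e\in E(G)$, and $N[e]\cap\mathcal{C}_E\neq N[f]\cap\mathcal{C}_E$ for all distinct $e,f\in E(G)$. A pair of adjacent edges $ux,uy$ ($x\neq y$) of $G$ is pendant if either both $x,y$ have degree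 $1$, or both $x,y$ have degree $2$ and $xy\in E(G)$; $G$ is pendant-free if it has no pendant pair (equivalently, $G$ has an edge-identifying code), and then $\gamma^{\mathrm{EID}}(G)$ is the minimum size of an edge-identifying code. IDCODE (resp. EDGE-IDCODE) asks, given a graph and an integer $k$, whether the graph has an identifying code (resp. edge-identifying code) of size at most $k$; the associated optimization problem asks for a code of minimum size. *)

theory Defs
  imports "HOL-Computational_Algebra.Polynomial"
begin

section \<open>Graphs, line graphs and identifying codes\<close>

datatype 'a ugraph = UGraph (verts: "'a set") (edges: "'a set set")

definition simple_graph :: "'a ugraph \<Rightarrow> bool" where
  "simple_graph G \<longleftrightarrow> finite (verts G) \<and> (\<forall>e\<in>edges G. e \<subseteq> verts G \<and> card e = 2)"

definition graph_isomorphic :: "'a ugraph \<Rightarrow> 'b ugraph \<Rightarrow> bool" where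
  "graph_isomorphic G H \<longleftrightarrow>
     (\<exists>f. bij_betw f (verts G) (verts H) \<and>
          (\<forall>u\<in>verts G. \<forall>v\<in>verts G. {u, v} \<in> edges G \<longleftrightarrow> {f u, f v} \<in> edges H))"

definition line_graph :: "'a ugraph \<Rightarrow> 'a set ugraph" where
  "line_graph G =
     UGraph (edges G) {{e, f} | e f. e \<in> edges G \<and> f \<in> edges G \<and> e \<noteq> f \<and> e \<inter> f \<noteq> {}}"

text \<open>
  Graphs are finite, so letting the root graph range over graphs with vertices in
  \<^typ>\<open>nat\<close> is no restriction.
\<close>

definition is_line_graph :: "'a ugraph \<Rightarrow> bool" where
  "is_line_graph H \<longleftrightarrow>
     (\<exists>G :: nat ugraph. simple_graph G \<and> graph_isomorphic H (line_graph G))"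

definition closed_nbhd :: "'a ugraph \<Rightarrow> 'a \<Rightarrow> 'a set" where
  "closed_nbhd H v = {u \<in> verts H. u = v \<or> {u, v} \<in> edges H}"

definition identifying_code :: "'a ugraph \<Rightarrow> 'a set \<Rightarrow> bool" where
  "identifying_code H C \<longleftrightarrow>
     C \<subseteq> verts H \<and>
     (\<forall>v\<in>verts H. closed_nbhd H v \<inter> C \<noteq> {}) \<and>
     (\<forall>u\<in>verts H. \<forall>v\<in>verts H. u \<noteq> v \<longrightarrow> closed_nbhd H u \<inter> C \<noteq> closed_nbhd H v \<inter> C)"

definition twin_free :: "'a ugraph \<Rightarrow> bool" where
  "twin_free H \<longleftrightarrow>
     (\<forall>x\<in>verts H. \<forall>y\<in>verts H. x \<noteq> y \<longrightarrow> closed_nbhd H x \<noteq> closed_nbhd H y)"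

definition gamma_ID :: "'a ugraph \<Rightarrow> nat" where
  "gamma_ID H = (LEAST k. \<exists>C. identifying_code H C \<and> card C = k)"

definition edge_closed_nbhd :: "'a ugraph \<Rightarrow> 'a set \<Rightarrow> 'a set set" where
  "edge_closed_nbhd G e = {f \<in> edges G. f = e \<or> f \<inter> e \<noteq> {}}"

definition edge_identifying_code :: "'a ugraph \<Rightarrow> 'a set set \<Rightarrow> bool" where
  "edge_identifying_code G C \<longleftrightarrow>
     C \<subseteq> edges G \<and>
     (\<forall>e\<in>edges G. edge_closed_nbhd G e \<inter> C \<noteq> {}) \<and>
     (\<forall>e\<in>edges G. \<forall>f\<in>edges G. e \<noteq> f \<longrightarrow>
        edge_closed_nbhd G e \<inter> C \<noteq> edge_closed_nbhd G f \<inter> C)"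

definition vdegree :: "'a ugraph \<Rightarrow> 'a \<Rightarrow> nat" where
  "vdegree G v = card {e \<in> edges G. v \<in> e}"

definition pendant_pair :: "'a ugraph \<Rightarrow> 'a set \<Rightarrow> 'a set \<Rightarrow> bool" where
  "pendant_pair G e f \<longleftrightarrow>
     (\<exists>u x y. x \<noteq> y \<and> e = {u, x} \<and> f = {u, y} \<and> e \<in> edges G \<and> f \<in> edges G \<and>
        (vdegree G x = 1 \<and> vdegree G y = 1 \<or>
         vdegree G x = 2 \<and> vdegree G y = 2 \<and> {x, y} \<in> edges G))"

definition pendant_free :: "'a ugraph \<Rightarrow> bool" where
  "pendant_free G \<longleftrightarrow> (\<nexists>e f. pendant_pair G e f)"

definition gamma_EID :: "'a ugraph \<Rightarrow> nat" where
  "gamma_EID G = (LEAST k. \<exists>C. edge_identifying_code G C \<and> card C = k)"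


section \<open>Polynomial time\<close>

text \<open>
  Algorithms are structured programs for a random access machine with finitely many named
  registers and an unbounded memory, both holding natural numbers; a state is a pair of the
  register contents and the memory contents. Every elementary instruction and every test costs
  one unit. Since there is no multiplication, the numbers produced in \<open>t\<close> steps by a fixed
  program have binary length at most linear in \<open>t\<close> and the logarithm of the input length,
  so that polynomial time here coincides with polynomial time on Turing machines.
\<close>

type_synonym state = "(nat \<Rightarrow> nat) \<times> (nat \<Rightarrow> nat)"

datatype com =
    Skip
  | Const nat nat
  | Add nat nat nat
  | Sub nat nat nat
  | Load nat nat
  | Store nat nat
  | Seq com com
  | IfNZ nat com com
  | WhileNZ nat com

text \<open>\<open>exec c s t s'\<close>: started in \<open>s\<close>, the program \<open>c\<close> halts in \<open>s'\<close> after exactly \<open>t\<close> steps.\<close>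

inductive exec :: "com \<Rightarrow> state \<Rightarrow> nat \<Rightarrow> state \<Rightarrow> bool" where
  Skip: "exec Skip s 1 s"
| Const: "exec (Const i k) (r, m) 1 (r(i := k), m)"
| Add: "exec (Add i j k) (r, m) 1 (r(i := r j + r k), m)"
| Sub: "exec (Sub i j k) (r, m) 1 (r(i := r j - r k), m)"
| Load: "exec (Load i j) (r, m) 1 (r(i := m (r j)), m)"
| Store: "exec (Store i j) (r, m) 1 (r, m(r i := r j))"
| Seq: "exec c s t s' \<Longrightarrow> exec d s' t' s'' \<Longrightarrow> exec (Seq c d) s (t + t') s''"
| IfTrue: "fst s i \<noteq> 0 \<Longrightarrow> exec c s t s' \<Longrightarrow> exec (IfNZ i c d) s (1 + t) s'"
| IfFalse: "fst s i = 0 \<Longrightarrow> exec d s t s' \<Longrightarrow> exec (IfNZ i c d) s (1 + t) s'"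
| WhileFalse: "fst s i = 0 \<Longrightarrow> exec (WhileNZ i c) s 1 s"
| WhileTrue: "fst s i \<noteq> 0 \<Longrightarrow> exec c s t s' \<Longrightarrow> exec (WhileNZ i c) s' t' s'' \<Longrightarrow>
    exec (WhileNZ i c) s (1 + t + t') s''"

lemma exec_deterministic:
  "exec c s t s' \<Longrightarrow> exec c s u s'' \<Longrightarrow> u = t \<and> s'' = s'"
proof (induction arbitrary: u s'' rule: exec.induct)
  case (Seq c s t s1 d t' s2)
  from Seq.prems show ?case
  proof cases
    case (Seq v w v')
    with Seq.IH(1)[OF Seq(2)] Seq.IH(2)[of v' s''] show ?thesis by simp
  qed
next
  case (IfTrue s i c t s' d)
  from IfTrue.prems show ?case
    by cases (use IfTrue.hyps(1) in \<open>auto dest!: IfTrue.IH\<close>)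
next
  case (IfFalse s i d t s' c)
  from IfFalse.prems show ?case
    by cases (use IfFalse.hyps(1) in \<open>auto dest!: IfFalse.IH\<close>)
next
  case (WhileFalse s i c)
  from WhileFalse.prems show ?case
    by cases (use WhileFalse.hyps in auto)
next
  case (WhileTrue s i c t s1 t' s2)
  from WhileTrue.prems show ?case
  proof cases
    case WhileFalse
    with WhileTrue.hyps(1) show ?thesis by simp
  next
    case (WhileTrue v w v')
    with WhileTrue.IH(1)[OF WhileTrue(3)] WhileTrue.IH(2)[of v' s''] show ?thesis by simp
  qed
qed (erule exec.cases; simp)+

text \<open>
  A bit string \<open>x\<close> is presented, as input and as output, by its length in register \<open>0\<close> and its
  bits in the memory cells with addresses below \<open>length x\<close>. Initially everything else is \<open>0\<close>.
\<close>

definition input_state :: "bool list \<Rightarrow> state" where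
  "input_state x =
     ((\<lambda>_. 0)(0 := length x), (\<lambda>a. if a < length x then of_bool (x ! a) else 0))"

definition holds_output :: "state \<Rightarrow> bool list \<Rightarrow> bool" where
  "holds_output s y \<longleftrightarrow> fst s 0 = length y \<and> (\<forall>a<length y. snd s a = of_bool (y ! a))"

definition outputs_within :: "com \<Rightarrow> bool list \<Rightarrow> nat \<Rightarrow> bool list \<Rightarrow> bool" where
  "outputs_within A x T y \<longleftrightarrow>
     (\<exists>t s. exec A (input_state x) t s \<and> t \<le> T \<and> holds_output s y)"

text \<open>
  Graphs given to an algorithm have vertices \<open>0, \<dots>, n - 1\<close>. A graph, or a set of edges of a
  graph, is encoded by its \<open>n \<times> n\<close> adjacency matrix, read row by row; a set of vertices is
  encoded by its characteristic vector of length \<open>n\<close>.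
\<close>

definition std_graph :: "nat ugraph \<Rightarrow> bool" where
  "std_graph G \<longleftrightarrow> simple_graph G \<and> (\<exists>n. verts G = {0..<n})"

definition encode_edge_set :: "nat ugraph \<Rightarrow> nat set set \<Rightarrow> bool list" where
  "encode_edge_set G C =
     (let n = card (verts G) in concat (map (\<lambda>i. map (\<lambda>j. {i, j} \<in> C) [0..<n]) [0..<n]))"

definition encode_graph :: "nat ugraph \<Rightarrow> bool list" where
  "encode_graph G = encode_edge_set G (edges G)"

definition encode_vertex_set :: "nat ugraph \<Rightarrow> nat set \<Rightarrow> bool list" where
  "encode_vertex_set H C = map (\<lambda>v. v \<in> C) [0..<card (verts H)]"

end

theory Submission
  imports Defs
begin

text \<open>
  Both algorithms delete elements one after the other, as long as what remains is a code, and
  output the inclusion-minimal code that is left. Supersets of codes are codes, so an element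
  that could not be deleted when it was tried cannot be deleted later either, and one pass
  suffices. The factor \<open>4\<close> holds for every inclusion-minimal code, because the number of
  non-isolated vertices of the graph bounds the sizes of codes from both sides.

  Lower bound (\<open>card_nonisolated_le\<close>): a graph with an edge-identifying code \<open>C\<close> has at most
  \<open>2 |C|\<close> non-isolated vertices. Those not covered by \<open>C\<close> are mapped injectively to covered
  vertices of degree at least \<open>2\<close> in \<open>C\<close>; hence the number of all of them is at most the sum of
  the degrees in \<open>C\<close>, which is \<open>2 |C|\<close>.

  Upper bound (\<open>minimal_code_card_le\<close>): an inclusion-minimal edge-identifying code \<open>C\<close> spans a
  2-degenerate graph, so that \<open>|C|\<close> is at most twice the number of vertices covered by \<open>C\<close>. Each
  edge of \<open>C\<close> is needed to dominate an edge or to separate two edges, and this forces an end of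
  degree at most \<open>2\<close> in \<open>C\<close>, or of degree \<open>3\<close> with a neighbour of degree at most \<open>2\<close>.

  An isomorphism between \<open>H\<close> and a line graph of \<open>G\<close> carries identifying codes of \<open>H\<close> to
  edge-identifying codes of \<open>G\<close> and preserves minimality. The same greedy deletion therefore
  works on \<open>H\<close> directly, without computing \<open>G\<close>.

  For the running time it remains to test the code property in polynomial time. In both cases it
  is a first-order property of the adjacency matrix and of the matrix of the cells deleted so far.
  A fixed first-order formula compiles to a program with one nested loop per quantifier
  (\<open>runs_compile\<close>), and \<open>runs_greedy_prog\<close> gives the greedy deletion for an arbitrary formula that
  defines an upward closed family of sets of cells.
\<close>

section \<open>Stars and traces of edge sets\<close>

definition star :: "'a set set \<Rightarrow> 'a \<Rightarrow> 'a set set" where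
  "star C v = {e \<in> C. v \<in> e}"

text \<open>
  On edges, the closed neighbourhood restricted to \<open>C\<close> is the trace, since an edge meets itself.
  The trace of an edge is the union of the stars of its two ends.
\<close>

definition trace :: "'a set set \<Rightarrow> 'a set \<Rightarrow> 'a set set" where
  "trace C e = {g \<in> C. g \<inter> e \<noteq> {}}"

lemma star_iff [simp]: "g \<in> star C v \<longleftrightarrow> g \<in> C \<and> v \<in> g"
  by (simp add: star_def)

lemma trace_iff [simp]: "g \<in> trace C e \<longleftrightarrow> g \<in> C \<and> g \<inter> e \<noteq> {}"
  by (simp add: trace_def)

lemma trace_edge: "trace C {u, w} = star C u \<union> star C w"
  by auto

lemma simple_graph_finite_edges: "simple_graph G \<Longrightarrow> finite (edges G)"
  unfolding simple_graph_def
  by (rule finite_subset[of _ "Pow (verts G)"]) auto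

lemma simple_graph_edgeE:
  assumes "simple_graph G" "e \<in> edges G" "u \<in> e"
  obtains w where "w \<noteq> u" "e = {u, w}"
proof -
  have "card e = 2" using assms by (auto simp: simple_graph_def)
  then obtain a b where "e = {a, b}" "a \<noteq> b" by (auto simp: card_2_iff)
  with assms(3) that[of a] that[of b] show ?thesis by auto
qed

lemma simple_graph_edge_nonempty: "simple_graph G \<Longrightarrow> e \<in> edges G \<Longrightarrow> e \<noteq> {}"
  by (auto simp: simple_graph_def)

lemma edge_identifying_code_iff_trace:
  assumes "simple_graph G"
  shows "edge_identifying_code G C \<longleftrightarrow> C \<subseteq> edges G \<and> (\<forall>e\<in>edges G. trace C e \<noteq> {}) \<and>
    (\<forall>e\<in>edges G. \<forall>f\<in>edges G. e \<noteq> f \<longrightarrow> trace C e \<noteq> trace C f)"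
proof -
  have "edge_closed_nbhd G e \<inter> C = trace C e" if "e \<in> edges G" "C \<subseteq> edges G" for e
    using that simple_graph_edge_nonempty[OF assms] by (auto simp: edge_closed_nbhd_def)
  then show ?thesis
    by (cases "C \<subseteq> edges G") (simp_all add: edge_identifying_code_def)
qed

lemma code_finite: "simple_graph G \<Longrightarrow> edge_identifying_code G C \<Longrightarrow> finite C"
  by (meson edge_identifying_code_def finite_subset simple_graph_finite_edges)

lemma code_dest:
  assumes "simple_graph G" "edge_identifying_code G C"
  shows "C \<subseteq> edges G" "e \<in> edges G \<Longrightarrow> trace C e \<noteq> {}"
    "e \<in> edges G \<Longrightarrow> f \<in> edges G \<Longrightarrow> trace C e = trace C f \<Longrightarrow> e = f"
  using assms edge_identifying_code_iff_trace[OF assms(1)] by blast+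


section \<open>Codes and the number of non-isolated vertices\<close>

lemma sum_card_star:
  assumes "finite C" "\<And>e. e \<in> C \<Longrightarrow> card e = 2"
  shows "(\<Sum>v\<in>\<Union>C. card (star C v)) = 2 * card C"
proof -
  have fin: "finite (\<Union>C)" using assms by (metis card.infinite finite_Union zero_neq_numeral)
  have "(\<Sum>v\<in>\<Union>C. card (star C v)) = (\<Sum>e\<in>C. card {v \<in> \<Union>C. v \<in> e})"
    using sum.swap_restrict[OF fin assms(1), of "\<lambda>_ _. 1::nat" "\<lambda>v e. v \<in> e"]
    by (simp add: star_def)
  also have "\<dots> = (\<Sum>e\<in>C. card e)"
    by (rule sum.cong) (auto intro!: arg_cong[of _ _ card])
  also have "\<dots> = 2 * card C" using assms(2) by simp
  finally show ?thesis .
qed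

text \<open>
  The injection behind the lower bound. An edge \<open>xu\<close> from an uncovered vertex \<open>x\<close> to a covered
  vertex \<open>u\<close> has the star of \<open>u\<close> as its trace. If \<open>u\<close> has degree at least \<open>2\<close> in \<open>C\<close>, then \<open>x\<close> is
  mapped to \<open>v = u\<close>. If \<open>u\<close> is a leaf of \<open>C\<close> with neighbour \<open>v\<close>, then \<open>x\<close> is mapped to \<open>v\<close>, and \<open>v\<close> has
  degree at least \<open>2\<close>: otherwise \<open>xu\<close> and \<open>uv\<close> had the same trace. In both cases some edge \<open>e\<close> at \<open>v\<close> has
  the star of \<open>v\<close> as its trace; as \<open>C\<close> separates edges, \<open>v\<close> determines \<open>e\<close>. In turn \<open>e\<close>
  determines \<open>x\<close>: either \<open>x\<close> is the uncovered end of \<open>e\<close>, or both ends are covered and \<open>xu\<close> is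
  the only edge with trace \<open>{e}\<close>.
\<close>

lemma uncovered_vertex_witness:
  assumes G: "simple_graph G" and C: "edge_identifying_code G C"
    and x: "x \<in> \<Union>(edges G)" "x \<notin> \<Union>C"
  shows "\<exists>v e. v \<in> \<Union>C \<and> card (star C v) \<ge> 2 \<and> e \<in> edges G \<and> trace C e = star C v \<and>
    (e = {x, v} \<or> (\<exists>u. u \<in> \<Union>C \<and> e = {u, v} \<and> {x, u} \<in> edges G \<and> star C u = {{u, v}}))"
proof -
  obtain u where u: "{x, u} \<in> edges G" using x(1) simple_graph_edgeE[OF G] by (metis UnionE)
  have tr: "trace C {x, y} = star C y" for y using x(2) by (auto simp: trace_edge)
  have "star C u \<noteq> {}" using code_dest(2)[OF G C u] tr by simp
  then have uU: "u \<in> \<Union>C" by auto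
  have fin: "finite (star C u)" using code_finite[OF G C] by (simp add: star_def)
  show ?thesis
  proof (cases "card (star C u) \<ge> 2")
    case True
    with u uU tr show ?thesis by blast
  next
    case False
    with \<open>star C u \<noteq> {}\<close> fin have "card (star C u) = 1"
      by (metis One_nat_def Suc_leI card_gt_0_iff le_antisym not_less_eq_eq numeral_2_eq_2)
    then obtain g where g: "star C u = {g}" by (auto simp: card_1_singleton_iff)
    then have gC: "g \<in> C" "u \<in> g" using star_iff[of g C u] by simp_all
    then have gE: "g \<in> edges G" using code_dest(1)[OF G C] by auto
    then obtain v where v: "v \<noteq> u" "g = {u, v}" using simple_graph_edgeE[OF G gE gC(2)] by metis
    have vU: "v \<in> \<Union>C" using gC v by auto
    have tg: "trace C g = star C v" unfolding v trace_edge using g gC v by auto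
    have "{x, u} \<noteq> g" using gC x(2) by auto
    then have "star C v \<noteq> star C u" using tg tr code_dest(3)[OF G C u gE] by auto
    moreover have "g \<in> star C v" using gC v by auto
    ultimately obtain h where "h \<in> star C v" "h \<noteq> g" unfolding g by blast
    then have "{g, h} \<subseteq> star C v" using \<open>g \<in> star C v\<close> by simp
    then have "card {g, h} \<le> card (star C v)" 
      by (rule card_mono[rotated]) (use code_finite[OF G C] in \<open>simp add: star_def\<close>)
    then have "card (star C v) \<ge> 2" using \<open>h \<noteq> g\<close> by simp
    moreover have "\<exists>u. u \<in> \<Union>C \<and> g = {u, v} \<and> {x, u} \<in> edges G \<and> star C u = {{u, v}}"
      by (rule exI[of _ u]) (simp only: uU v(2) u g simp_thms)
    ultimately show ?thesis using vU gE tg by (metis (lifting))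
  qed
qed

text \<open>
  Every covered vertex counts once for itself and once more if an uncovered vertex is mapped to it.
  The second happens only at degree at least \<open>2\<close>, so that the count is bounded by the degree.
\<close>

lemma card_nonisolated_le:
  assumes G: "simple_graph G" and C: "edge_identifying_code G C"
  shows "card (\<Union>(edges G)) \<le> 2 * card C"
proof -
  let ?U = "\<Union>C" and ?O = "\<Union>(edges G) - \<Union>C"
  have card2: "e \<in> C \<Longrightarrow> card e = 2" for e
    using code_dest(1)[OF G C] G by (auto simp: simple_graph_def)
  have finC: "finite C" by (rule code_finite[OF G C])
  have finE: "finite (\<Union>(edges G))"
    using G by (auto simp: simple_graph_def intro: finite_subset[of _ "verts G"])
  have sub: "?U \<subseteq> \<Union>(edges G)" using code_dest(1)[OF G C] by blast
  have finU: "finite ?U" using finite_subset[OF sub finE] .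
  let ?D = "{v \<in> ?U. card (star C v) \<ge> 2}"
  define R where "R x v e \<longleftrightarrow> v \<in> ?U \<and> card (star C v) \<ge> 2 \<and> e \<in> edges G \<and> trace C e = star C v \<and>
    (e = {x, v} \<or> (\<exists>u. u \<in> ?U \<and> e = {u, v} \<and> {x, u} \<in> edges G \<and> star C u = {{u, v}}))" for x v e
  have "\<forall>x\<in>?O. \<exists>v e. R x v e" using uncovered_vertex_witness[OF G C] unfolding R_def by blast
  then obtain g h where gh: "\<And>x. x \<in> ?O \<Longrightarrow> R x (g x) (h x)" by metis
  have "inj_on g ?O"
  proof (rule inj_onI)
    fix x y assume xy: "x \<in> ?O" "y \<in> ?O" "g x = g y"
    have R: "R x (g x) (h x)" "R y (g x) (h y)" using gh[OF xy(1)] gh[OF xy(2)] unfolding xy(3)[symmetric] by blast+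
    then have heq: "h x = h y" using code_dest(3)[OF G C, of "h x" "h y"] unfolding R_def by metis
    have tr: "trace C {z, w} = star C w" if "z \<notin> ?U" for z w using that by (auto simp: trace_edge)
    show "x = y"
    proof (cases "h x = {x, g x} \<or> h y = {y, g x}")
      case True
      then show ?thesis using R heq xy unfolding R_def by (metis DiffD2 doubleton_eq_iff)
    next
      case False
      then have ne: "h x \<noteq> {x, g x}" "h y \<noteq> {y, g x}" by simp_all
      obtain u where u: "h x = {u, g x}" "{x, u} \<in> edges G"
        using R(1) ne(1) unfolding R_def by (elim conjE disjE exE) simp_all
      obtain u' where u': "h y = {u', g x}" "{y, u'} \<in> edges G"
        using R(2) ne(2) unfolding R_def by (elim conjE disjE exE) simp_all
      have "u' = u" using heq u(1) u'(1) by (metis doubleton_eq_iff)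
      moreover have "trace C {x, u} = trace C {y, u}" using tr xy(1,2) by simp
      ultimately have "{x, u} = {y, u}" using code_dest(3)[OF G C u(2)] u'(2) by simp
      then show ?thesis by (metis doubleton_eq_iff)
    qed
  qed
  moreover have "g ` ?O \<subseteq> ?D" using gh unfolding R_def by blast
  moreover have "finite ?D" by (rule finite_subset[OF _ finU]) auto
  ultimately have "card ?O \<le> card ?D" by (rule card_inj_on_le)
  also have "card ?D = (\<Sum>v\<in>?U. of_bool (card (star C v) \<ge> 2))"
    using finU by (simp add: Int_def)
  finally have "card ?U + card ?O \<le> (\<Sum>v\<in>?U. 1 + of_bool (card (star C v) \<ge> 2))"
    by (simp add: sum.distrib sum_Suc)
  also have "\<dots> \<le> (\<Sum>v\<in>?U. card (star C v))"
  proof (rule sum_mono)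
    fix v assume "v \<in> ?U"
    then have "card (star C v) \<noteq> 0" using finC by (auto simp: card_eq_0_iff star_def)
    then show "1 + of_bool (card (star C v) \<ge> 2) \<le> card (star C v)" by auto
  qed
  also have "\<dots> = 2 * card C" by (rule sum_card_star[OF finC card2])
  finally show ?thesis using card_Un_disjoint[of ?U ?O] finU finE sub
    by (simp add: Un_absorb1)
qed


section \<open>Minimal codes are 2-degenerate\<close>

text \<open>
  Deleting a vertex of degree at most \<open>2\<close> removes at least one covered vertex and at most two edges.
\<close>

lemma card_le_two_degenerate:
  fixes C :: "'a set set"
  assumes "finite C" "\<And>e. e \<in> C \<Longrightarrow> finite e"
    and "\<And>S. S \<subseteq> C \<Longrightarrow> S \<noteq> {} \<Longrightarrow> \<exists>v\<in>\<Union>S. card (star S v) \<le> 2"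
  shows "card C \<le> 2 * card (\<Union>C)"
  using assms
proof (induction "card C" arbitrary: C rule: less_induct)
  case less
  show ?case
  proof (cases "C = {}")
    case False
    then obtain v where v: "v \<in> \<Union>C" "card (star C v) \<le> 2" using less.prems(3) by blast
    let ?D = "C - star C v"
    have D: "?D \<subseteq> C" by auto
    have finst: "finite (star C v)" using less.prems(1) by (simp add: star_def)
    have fin: "finite (\<Union>C)" using less.prems by auto
    have cD: "card ?D = card C - card (star C v)" by (rule card_Diff_subset[OF finst]) auto
    have "?D \<subset> C" using v by (auto simp: psubset_eq)
    then have "card ?D < card C" using less.prems(1) by (rule psubset_card_mono[rotated])
    then have "card ?D \<le> 2 * card (\<Union>?D)"
    proof (rule less.hyps)
      show "finite ?D" using less.prems(1) by simp
      show "finite e" if "e \<in> ?D" for e using that less.prems(2) by simp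
      show "\<exists>v\<in>\<Union>S. card (star S v) \<le> 2" if "S \<subseteq> ?D" "S \<noteq> {}" for S
        using less.prems(3)[OF subset_trans[OF that(1) D] that(2)] .
    qed
    moreover have "\<Union>?D \<subseteq> \<Union>C - {v}" by auto
    then have "card (\<Union>?D) \<le> card (\<Union>C - {v})" using fin by (intro card_mono) auto
    then have "card (\<Union>?D) \<le> card (\<Union>C) - 1" using v fin by simp
    moreover have "card (\<Union>C) > 0" using v fin by (auto simp: card_gt_0_iff)
    ultimately show ?thesis using v(2) cD by linarith
  qed simp
qed

text \<open>
  If \<open>C - {c}\<close> does not dominate \<open>e\<close>, then \<open>{c}\<close> is the trace of \<open>e\<close>, and an end of \<open>c\<close>
  that lies on \<open>e\<close> is a leaf of \<open>C\<close>. Otherwise two edges \<open>e = uw\<close> and \<open>f = ab\<close> have traces that differ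
  exactly in \<open>c = uv\<close>. Every edge of \<open>C\<close> at \<open>u\<close> other than \<open>c\<close> then meets \<open>f\<close>, so it is \<open>ua\<close> or \<open>ub\<close>, and \<open>u\<close>
  has degree at most \<open>3\<close>. With \<open>b \<noteq> w\<close>, every edge of \<open>C\<close> at \<open>b\<close> meets \<open>e\<close>, so it is \<open>bu\<close> or
  \<open>bw\<close>, and \<open>b\<close> has degree at most \<open>2\<close>. If \<open>ub\<close> is not in \<open>C\<close>, then \<open>u\<close> itself has
  degree at most \<open>2\<close>.
\<close>

lemma minimal_code_low_degree:
  assumes G: "simple_graph G" and C: "edge_identifying_code G C"
    and min: "\<not> edge_identifying_code G (C - {c})" and c: "c \<in> C"
  shows "\<exists>u\<in>c. card (star C u) \<le> 2 \<or>
    (card (star C u) \<le> 3 \<and> (\<exists>b. {u, b} \<in> C \<and> card (star C b) \<le> 2))"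
proof -
  have CE: "C \<subseteq> edges G" by (rule code_dest(1)[OF G C])
  have trD: "trace (C - {c}) e = trace C e - {c}" for e by auto
  have "C - {c} \<subseteq> edges G" using CE by blast
  with min have "\<not> ((\<forall>e\<in>edges G. trace C e - {c} \<noteq> {}) \<and>
      (\<forall>e\<in>edges G. \<forall>f\<in>edges G. e \<noteq> f \<longrightarrow> trace C e - {c} \<noteq> trace C f - {c}))"
    by (simp only: edge_identifying_code_iff_trace[OF G] trD simp_thms)
  then consider (dom) e where "e \<in> edges G" "trace C e - {c} = {}"
    | (sep) e f where "e \<in> edges G" "f \<in> edges G" "e \<noteq> f" "trace C e - {c} = trace C f - {c}"
    by metis
  then show ?thesis
  proof cases
    case dom
    then have "trace C e = {c}" using code_dest(2)[OF G C] by blast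
    then have "c \<inter> e \<noteq> {}" using trace_iff by (metis singletonI)
    then obtain u where u: "u \<in> c" "u \<in> e" by auto
    then have "star C u \<subseteq> {c}" using \<open>trace C e = {c}\<close>
      by (metis IntI empty_iff star_iff subsetI trace_iff)
    then have "card (star C u) \<le> card {c}" by (intro card_mono) auto
    then have "card (star C u) \<le> 2" by simp
    then show ?thesis using u(1) by blast
  next
    case sep
    have "\<exists>e f. e \<in> edges G \<and> f \<in> edges G \<and> c \<in> trace C e \<and> c \<notin> trace C f \<and> trace C e - {c} = trace C f"
    proof (cases "c \<in> trace C e")
      case True
      then show ?thesis using sep code_dest(3)[OF G C] by (metis Diff_empty Diff_insert0 insert_Diff)
    next
      case False
      then show ?thesis using sep code_dest(3)[OF G C] by (metis Diff_empty Diff_insert0)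
    qed
    then obtain e f where ef: "e \<in> edges G" "f \<in> edges G" "c \<in> trace C e" "c \<notin> trace C f"
      "trace C e - {c} = trace C f" by blast
    then obtain u where u: "u \<in> c" "u \<in> e" by auto
    obtain v where v: "c = {u, v}" using simple_graph_edgeE[OF G _ u(1)] c CE by blast
    obtain w where w: "e = {u, w}" using simple_graph_edgeE[OF G ef(1) u(2)] by blast
    have disj: "c \<inter> f = {}" using ef(4) c by auto
    \<comment> \<open>\<open>e\<close> and \<open>f\<close> may share \<open>w\<close>; then \<open>w\<close> is called \<open>a\<close>.\<close>
    obtain a b where f: "f = {a, b}" and bw: "b \<noteq> w"
    proof -
      from simple_graph_edge_nonempty[OF G ef(2)] obtain y where "y \<in> f" by auto
      with simple_graph_edgeE[OF G ef(2)] obtain z where "z \<noteq> y" "f = {y, z}" by metis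
      then show ?thesis using that[of y z] that[of z y] by (metis insert_commute)
    qed
    have nu: "u \<noteq> a" "u \<noteq> b" using disj u f by auto
    have nb: "g = {x, y}" if "g \<in> C" "x \<in> g" "y \<in> g" "x \<noteq> y" for g x y
      using simple_graph_edgeE[OF G _ that(2)] that CE by (metis empty_iff insert_iff subsetD)
    have su: "star C u \<subseteq> {{u, v}, {u, a}, {u, b}}"
    proof
      fix g assume g: "g \<in> star C u"
      show "g \<in> {{u, v}, {u, a}, {u, b}}"
      proof (cases "g = c")
        case False
        then have "g \<in> trace C e - {c}" using g u by auto
        then have "g \<in> trace C f" by (simp only: ef(5))
        then have "a \<in> g \<or> b \<in> g" using f by auto
        then show ?thesis using nb[of g u] g nu by auto
      qed (simp add: v)
    qed
    have sb: "star C b \<subseteq> {{b, u}, {b, w}}"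
    proof
      fix g assume g: "g \<in> star C b"
      then have "g \<in> trace C f" using f by auto
      then have "g \<in> trace C e" using ef(5) by blast
      then have "u \<in> g \<or> w \<in> g" using w by auto
      then show "g \<in> {{b, u}, {b, w}}" using nb[of g b] g nu bw by auto
    qed
    have "card (star C b) \<le> card {{b, u}, {b, w}}" using sb by (intro card_mono) auto
    also have "\<dots> \<le> 2" by (simp add: card_insert_if)
    finally have cb: "card (star C b) \<le> 2" .
    show ?thesis
    proof (cases "{u, b} \<in> C")
      case True
      have "card (star C u) \<le> card {{u, v}, {u, a}, {u, b}}" using su by (intro card_mono) auto
      also have "\<dots> \<le> 3" by (simp add: card_insert_if)
      finally show ?thesis using True cb u by blast
    next
      case False
      then have "g = {u, v} \<or> g = {u, a}" if g: "g \<in> star C u" for g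
      proof -
        have "g = {u, v} \<or> g = {u, a} \<or> g = {u, b}" using subsetD[OF su g] by simp
        moreover have "g \<noteq> {u, b}" using g False by (metis star_iff)
        ultimately show ?thesis by blast
      qed
      then have "star C u \<subseteq> {{u, v}, {u, a}}" by (intro subsetI) simp
      then have "card (star C u) \<le> card {{u, v}, {u, a}}" by (intro card_mono) auto
      also have "\<dots> \<le> 2" by (simp add: card_insert_if)
      finally show ?thesis using u by blast
    qed
  qed
qed

text \<open>
  In a nonempty subset \<open>S\<close> of a minimal code, take any edge and its end \<open>u\<close> from
  \<open>minimal_code_low_degree\<close>. If \<open>u\<close> has degree greater than \<open>2\<close> in \<open>S\<close>, then its degree in \<open>C\<close> is
  \<open>3\<close>, all its edges in \<open>C\<close> lie in \<open>S\<close>, and the neighbour \<open>b\<close> is a vertex of degree at most \<open>2\<close>.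
\<close>

lemma minimal_code_card_le:
  assumes G: "simple_graph G" and C: "edge_identifying_code G C"
    and min: "\<And>c. c \<in> C \<Longrightarrow> \<not> edge_identifying_code G (C - {c})"
  shows "card C \<le> 2 * card (\<Union>C)"
proof (rule card_le_two_degenerate)
  show finC: "finite C" by (rule code_finite[OF G C])
  show "finite e" if "e \<in> C" for e
    using that code_dest(1)[OF G C] G
    by (metis card.infinite simple_graph_def subsetD zero_neq_numeral)
  fix S assume S: "S \<subseteq> C" "S \<noteq> {}"
  then obtain c where c: "c \<in> S" by auto
  have fin: "finite (star C x)" for x using finC by (simp add: star_def)
  have le: "card (star S x) \<le> card (star C x)" for x
    using S fin by (intro card_mono) auto
  obtain u where u: "u \<in> c" "card (star C u) \<le> 2 \<or>
    (card (star C u) \<le> 3 \<and> (\<exists>b. {u, b} \<in> C \<and> card (star C b) \<le> 2))"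
    using minimal_code_low_degree[OF G C min] c S by blast
  show "\<exists>v\<in>\<Union>S. card (star S v) \<le> 2"
  proof (cases "card (star S u) \<le> 2")
    case True
    then show ?thesis using u c by blast
  next
    case False
    with u(2) le[of u] obtain b where b: "card (star C u) \<le> 3" "{u, b} \<in> C" "card (star C b) \<le> 2"
      by auto
    have "star S u = star C u" using S b False fin by (intro card_seteq) auto
    then have "{u, b} \<in> S" using b by (metis insertI1 star_iff)
    then show ?thesis using b le[of b] by (meson UnionI insertI1 insert_commute le_trans insertCI)
  qed
qed

lemma minimal_code_approximates:
  assumes G: "simple_graph G" and C: "edge_identifying_code G C"
    and min: "\<And>c. c \<in> C \<Longrightarrow> \<not> edge_identifying_code G (C - {c})"
    and C': "edge_identifying_code G C'"
  shows "card C \<le> 4 * card C'"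
proof -
  have "card (\<Union>C) \<le> card (\<Union>(edges G))"
    using code_dest(1)[OF G C] G
    by (intro card_mono Union_mono)
       (auto simp: simple_graph_def intro: finite_subset[of _ "verts G"])
  then show ?thesis
    using minimal_code_card_le[OF G C min] card_nonisolated_le[OF G C'] by linarith
qed

section \<open>Existence of codes and transfer to line graphs\<close>

lemma edge_identifying_code_mono:
  assumes "edge_identifying_code G C" "C \<subseteq> D" "D \<subseteq> edges G"
  shows "edge_identifying_code G D"
  using assms unfolding edge_identifying_code_def by blast

lemma identifying_code_mono:
  assumes "identifying_code G C" "C \<subseteq> D" "D \<subseteq> verts G"
  shows "identifying_code G D"
  using assms unfolding identifying_code_def by blast

lemma twin_free_code: "twin_free H \<Longrightarrow> identifying_code H (verts H)"
  unfolding identifying_code_def twin_free_def closed_nbhd_def by (auto simp: Int_def)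

text \<open>
  Edges \<open>ux\<close> and \<open>uy\<close> with the same closed neighbourhood form a pendant pair: every
  further edge at \<open>x\<close> must meet \<open>uy\<close>, hence is \<open>xy\<close>, and likewise at \<open>y\<close>.
\<close>

lemma pendant_free_code:
  assumes G: "simple_graph G" and pf: "pendant_free G"
  shows "edge_identifying_code G (edges G)"
proof -
  let ?E = "edges G"
  have "e = f" if ef: "e \<in> ?E" "f \<in> ?E" "trace ?E e = trace ?E f" for e f
  proof (rule ccontr)
    assume ne: "e \<noteq> f"
    have "e \<in> trace ?E e" using ef(1) simple_graph_edge_nonempty[OF G ef(1)] by auto
    then have "e \<in> trace ?E f" by (simp only: ef(3))
    then obtain u where u: "u \<in> e" "u \<in> f" by auto
    obtain x where x: "x \<noteq> u" "e = {u, x}" using simple_graph_edgeE[OF G ef(1) u(1)] .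
    obtain y where y: "y \<noteq> u" "f = {u, y}" using simple_graph_edgeE[OF G ef(2) u(2)] .
    have xy: "x \<noteq> y" using ne x y by auto
    have only: "g = {u, p} \<or> g = {p, q}"
      if "g \<in> ?E" "p \<in> g" "trace ?E {u, p} = trace ?E {u, q}" "p \<noteq> u" "p \<noteq> q" for g p q
    proof -
      have "g \<in> trace ?E {u, q}" using that(1-3) by (metis IntI empty_iff insertCI trace_iff)
      then have "u \<in> g \<or> q \<in> g" by auto
      then show ?thesis using simple_graph_edgeE[OF G that(1,2)] that(4,5) by auto
    qed
    have tr: "trace ?E {u, x} = trace ?E {u, y}" using ef(3) x(2) y(2) by simp
    have uE: "{u, x} \<in> ?E" "{u, y} \<in> ?E" using ef(1,2) x(2) y(2) by simp_all
    have sx: "g = {u, x} \<or> g = {x, y}" if "g \<in> star ?E x" for g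
      using only[OF _ _ tr x(1) xy] that by simp
    have sy: "g = {u, y} \<or> g = {x, y}" if "g \<in> star ?E y" for g
      using only[OF _ _ tr[symmetric] y(1) xy[symmetric]] that by (simp add: insert_commute)
    have deg: "vdegree G z = card (star ?E z)" for z by (simp add: vdegree_def star_def)
    have "vdegree G x = 1 \<and> vdegree G y = 1 \<or>
      vdegree G x = 2 \<and> vdegree G y = 2 \<and> {x, y} \<in> ?E"
    proof (cases "{x, y} \<in> ?E")
      case True
      have "star ?E x = {{u, x}, {x, y}}" by (intro equalityI subsetI) (use sx uE True in auto)
      moreover have "star ?E y = {{u, y}, {x, y}}" by (intro equalityI subsetI) (use sy uE True in auto)
      ultimately show ?thesis using True xy x(1) y(1) by (simp add: deg doubleton_eq_iff)
    next
      case False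
      have "star ?E x = {{u, x}}" by (intro equalityI subsetI) (use sx uE False in auto)
      moreover have "star ?E y = {{u, y}}" by (intro equalityI subsetI) (use sy uE False in auto)
      ultimately show ?thesis by (simp add: deg)
    qed
    then have "pendant_pair G e f" unfolding pendant_pair_def using x(2) y(2) xy ef(1,2) by blast
    then show False using pf by (auto simp: pendant_free_def)
  qed
  then show ?thesis unfolding edge_identifying_code_iff_trace[OF G]
    using simple_graph_edge_nonempty[OF G] by (auto simp: trace_def)
qed

lemma gamma_EID_witness:
  assumes "edge_identifying_code G C"
  obtains C' where "edge_identifying_code G C'" "card C' = gamma_EID G"
  using LeastI[of "\<lambda>k. \<exists>C. edge_identifying_code G C \<and> card C = k" "card C"] assms
  unfolding gamma_EID_def by blast

lemma gamma_ID_witness: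
  assumes "identifying_code G C"
  obtains C' where "identifying_code G C'" "card C' = gamma_ID G"
  using LeastI[of "\<lambda>k. \<exists>C. identifying_code G C \<and> card C = k" "card C"] assms
  unfolding gamma_ID_def by blast

lemma identifying_code_iso_line_graph:
  assumes G: "simple_graph G" 
    and f: "bij_betw f (verts H) (edges G)"
    and adj: "\<forall>u\<in>verts H. \<forall>v\<in>verts H. {u, v} \<in> edges H \<longleftrightarrow> {f u, f v} \<in> edges (line_graph G)"
    and C: "C \<subseteq> verts H"
  shows "identifying_code H C \<longleftrightarrow> edge_identifying_code G (f ` C)"
proof -
  have inj: "inj_on f (verts H)" and im: "edges G = f ` verts H"
    using f by (auto simp: bij_betw_def)
  have tr: "trace (f ` C) (f v) = f ` (closed_nbhd H v \<inter> C)" if v: "v \<in> verts H" for v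
  proof -
    have "f u \<inter> f v \<noteq> {} \<longleftrightarrow> u \<in> closed_nbhd H v" if u: "u \<in> verts H" for u
    proof (cases "u = v")
      case True
      then show ?thesis using v simple_graph_edge_nonempty[OF G] im by (auto simp: closed_nbhd_def)
    next
      case False
      have fe: "f u \<noteq> f v" "f u \<in> edges G" "f v \<in> edges G"
        using False u v inj im by (auto simp: inj_on_def)
      have "u \<in> closed_nbhd H v \<longleftrightarrow> {f u, f v} \<in> edges (line_graph G)"
        using False u v adj by (auto simp: closed_nbhd_def)
      also have "\<dots> \<longleftrightarrow> f u \<inter> f v \<noteq> {}"
        using fe by (auto simp: line_graph_def doubleton_eq_iff)
      finally show ?thesis by simp
    qed
    then show ?thesis using C by (auto simp: trace_def)
  qed
  have eq: "trace (f ` C) (f u) = trace (f ` C) (f v) \<longleftrightarrow>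
      closed_nbhd H u \<inter> C = closed_nbhd H v \<inter> C" if "u \<in> verts H" "v \<in> verts H" for u v
    using inj_on_image_eq_iff[OF inj, of "closed_nbhd H u \<inter> C" "closed_nbhd H v \<inter> C"] C that
    by (simp add: tr le_infI2)
  have "f u = f v \<longleftrightarrow> u = v" if "u \<in> verts H" "v \<in> verts H" for u v
    using inj that by (auto simp: inj_on_def)
  then show ?thesis
    unfolding identifying_code_def edge_identifying_code_iff_trace[OF G] im
    using C eq by (simp add: tr image_mono)
qed

lemma minimal_line_graph_code_approximates:
  assumes H: "is_line_graph H" and C: "identifying_code H C"
    and min: "\<And>c. c \<in> C \<Longrightarrow> \<not> identifying_code H (C - {c})"
    and C': "identifying_code H C'"
  shows "card C \<le> 4 * card C'"
proof -
  obtain G :: "nat ugraph" and f where G: "simple_graph G"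
    and f: "bij_betw f (verts H) (edges G)"
    and adj: "\<forall>u\<in>verts H. \<forall>v\<in>verts H. {u, v} \<in> edges H \<longleftrightarrow> {f u, f v} \<in> edges (line_graph G)"
    using H by (auto simp: is_line_graph_def graph_isomorphic_def line_graph_def)
  note iso = identifying_code_iso_line_graph[OF G f adj]
  have sub: "C \<subseteq> verts H" "C' \<subseteq> verts H" using C C' by (auto simp: identifying_code_def)
  have inj: "inj_on f (verts H)" using f by (simp add: bij_betw_def)
  have "card (f ` C) \<le> 4 * card (f ` C')"
  proof (rule minimal_code_approximates[OF G])
    show "edge_identifying_code G (f ` C)" "edge_identifying_code G (f ` C')"
      using iso sub C C' by auto
    fix c assume "c \<in> f ` C"
    then obtain v where v: "v \<in> C" "c = f v" by auto
    have "f ` C - {c} = f ` (C - {v})"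
      using inj_on_image_set_diff[OF inj, of C "{v}"] v sub by auto
    then show "\<not> edge_identifying_code G (f ` C - {c})"
      using iso[of "C - {v}"] min[OF v(1)] sub by auto
  qed
  then show ?thesis using inj sub by (metis card_image inj_on_subset)
qed

section \<open>Programs with time bounds\<close>

text \<open>
  Weakest preconditions with a time budget. The rules below compute an upper bound for the running time
  along with the postcondition; a conditional is charged for both branches, which keeps the bounds
  polynomial and avoids maxima.
\<close>

definition runs :: "com \<Rightarrow> state \<Rightarrow> nat \<Rightarrow> (state \<Rightarrow> bool) \<Rightarrow> bool" where
  "runs c s T Q \<longleftrightarrow> (\<exists>t s'. exec c s t s' \<and> t \<le> T \<and> Q s')"

lemma runs_weaken:
  "runs c s T Q \<Longrightarrow> T \<le> T' \<Longrightarrow> (\<And>s'. Q s' \<Longrightarrow> Q' s') \<Longrightarrow> runs c s T' Q'"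
  unfolding runs_def by (meson le_trans)

lemma runs_atomic:
  "Q s \<Longrightarrow> runs Skip s 1 Q"
  "Q (r(i := k), m) \<Longrightarrow> runs (Const i k) (r, m) 1 Q"
  "Q (r(i := r j + r k), m) \<Longrightarrow> runs (Add i j k) (r, m) 1 Q"
  "Q (r(i := r j - r k), m) \<Longrightarrow> runs (Sub i j k) (r, m) 1 Q"
  "Q (r(i := m (r j)), m) \<Longrightarrow> runs (Load i j) (r, m) 1 Q"
  "Q (r, m(r i := r j)) \<Longrightarrow> runs (Store i j) (r, m) 1 Q"
  unfolding runs_def by (blast intro: exec.intros)+

lemma runs_Seq:
  "runs c s T (\<lambda>s'. runs d s' T' Q) \<Longrightarrow> runs (Seq c d) s (T + T') Q"
  unfolding runs_def by (meson add_mono exec.Seq)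

lemma runs_IfNZ:
  assumes "fst s i \<noteq> 0 \<Longrightarrow> runs c s T Q" "fst s i = 0 \<Longrightarrow> runs d s T' Q"
  shows "runs (IfNZ i c d) s (1 + (T + T')) Q"
proof (cases "fst s i = 0")
  case True
  then obtain t s' where "exec d s t s'" "t \<le> T'" "Q s'" using assms(2) by (auto simp: runs_def)
  with True show ?thesis unfolding runs_def
    by (intro exI[of _ "1 + t"] exI[of _ s']) (auto intro: exec.IfFalse[simplified])
next
  case False
  then obtain t s' where "exec c s t s'" "t \<le> T" "Q s'" using assms(1) by (auto simp: runs_def)
  with False show ?thesis unfolding runs_def
    by (intro exI[of _ "1 + t"] exI[of _ s']) (auto intro: exec.IfTrue[simplified])
qed

text \<open>
  The variant \<open>\<mu>\<close> proves termination and bounds the number of iterations at the same time.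
\<close>

lemma runs_WhileNZ:
  fixes \<mu> :: "state \<Rightarrow> nat"
  assumes "I s"
    and "\<And>s. I s \<Longrightarrow> fst s i \<noteq> 0 \<Longrightarrow> runs c s T (\<lambda>s'. I s' \<and> \<mu> s' < \<mu> s)"
  shows "runs (WhileNZ i c) s (\<mu> s * (T + 1) + 1) (\<lambda>s'. I s' \<and> fst s' i = 0)"
  using assms(1)
proof (induction "\<mu> s" arbitrary: s rule: less_induct)
  case less
  show ?case
  proof (cases "fst s i = 0")
    case True
    then have "exec (WhileNZ i c) s 1 s" by (rule exec.WhileFalse)
    then show ?thesis using True less.prems unfolding runs_def
      by (intro exI[of _ 1] exI[of _ s]) simp
  next
    case False
    obtain t s1 where 1: "exec c s t s1" "t \<le> T" "I s1" "\<mu> s1 < \<mu> s"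
      using assms(2)[OF less.prems False] by (auto simp: runs_def)
    obtain t' s2 where 2: "exec (WhileNZ i c) s1 t' s2" "t' \<le> \<mu> s1 * (T + 1) + 1" "I s2"
      "fst s2 i = 0"
      using less.hyps[OF 1(4,3)] by (auto simp: runs_def)
    have "(\<mu> s1 + 1) * (T + 1) \<le> \<mu> s * (T + 1)" using 1(4) by (intro mult_right_mono) auto
    then have "1 + t + t' \<le> \<mu> s * (T + 1) + 1" using 1(2) 2(2) by simp
    then show ?thesis using exec.WhileTrue[OF False 1(1) 2(1)] 2 unfolding runs_def by blast
  qed
qed

abbreviation seq_syntax :: "com \<Rightarrow> com \<Rightarrow> com"  (infixr ";;" 55) where "c ;; d \<equiv> Seq c d"

section \<open>Compiling first-order formulas\<close>

text \<open>
  First-order formulas over the universe \<open>{0..<n}\<close> with the order and two binary relations: the input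
  matrix in the memory cells \<open>0, \<dots>, n\<^sup>2 - 1\<close> and, directly above it, the matrix of the removed cells.
  Recording removals rather than the remaining cells makes the initial memory represent the full set
  of cells. Variables are de Bruijn levels: a quantifier at depth \<open>d\<close> binds variable \<open>d\<close>,
  which is appended to the assignment, so the registers of the outer variables never change.
\<close>

datatype fm =
    Less nat nat
  | Input nat nat
  | Removed nat nat
  | Neg fm
  | Conj fm fm
  | Exists fm

primrec holds :: "nat \<Rightarrow> (nat \<Rightarrow> nat) \<Rightarrow> nat list \<Rightarrow> fm \<Rightarrow> bool" where
  "holds n m \<sigma> (Less x y) \<longleftrightarrow> \<sigma> ! x < \<sigma> ! y"
| "holds n m \<sigma> (Input x y) \<longleftrightarrow> m (\<sigma> ! x * n + \<sigma> ! y) \<noteq> 0"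
| "holds n m \<sigma> (Removed x y) \<longleftrightarrow> m (n * n + \<sigma> ! x * n + \<sigma> ! y) \<noteq> 0"
| "holds n m \<sigma> (Neg \<phi>) \<longleftrightarrow> \<not> holds n m \<sigma> \<phi>"
| "holds n m \<sigma> (Conj \<phi> \<psi>) \<longleftrightarrow> holds n m \<sigma> \<phi> \<and> holds n m \<sigma> \<psi>"
| "holds n m \<sigma> (Exists \<phi>) \<longleftrightarrow> (\<exists>a<n. holds n m (\<sigma> @ [a]) \<phi>)"

primrec wf_fm :: "nat \<Rightarrow> fm \<Rightarrow> bool" where
  "wf_fm d (Less x y) \<longleftrightarrow> x < d \<and> y < d"
| "wf_fm d (Input x y) \<longleftrightarrow> x < d \<and> y < d"
| "wf_fm d (Removed x y) \<longleftrightarrow> x < d \<and> y < d"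
| "wf_fm d (Neg \<phi>) \<longleftrightarrow> wf_fm d \<phi>"
| "wf_fm d (Conj \<phi> \<psi>) \<longleftrightarrow> wf_fm d \<phi> \<and> wf_fm d \<psi>"
| "wf_fm d (Exists \<phi>) \<longleftrightarrow> wf_fm (Suc d) \<phi>"

text \<open>
  Registers \<open>0\<close> to \<open>3\<close> hold \<open>n\<^sup>2\<close>, \<open>n\<close>, \<open>1\<close> and \<open>0\<close> once \<open>n\<close> is known; the last and the
  first also serve as base addresses of the input matrix and of the matrix of removed cells.
  Each variable has a register for its value and one for the loop counter of its quantifier.
\<close>

abbreviation (input) "len_reg \<equiv> 0 :: nat"
abbreviation (input) "size_reg \<equiv> 1 :: nat"
abbreviation (input) "one_reg \<equiv> 2 :: nat"
abbreviation (input) "zero_reg \<equiv> 3 :: nat"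
abbreviation (input) "res_reg \<equiv> 4 :: nat"
abbreviation (input) "ptr_reg \<equiv> 5 :: nat"
abbreviation (input) "tmp_reg \<equiv> 6 :: nat"
abbreviation (input) val_reg :: "nat \<Rightarrow> nat" where "val_reg v \<equiv> 2 * v + 8"
abbreviation (input) cnt_reg :: "nat \<Rightarrow> nat" where "cnt_reg v \<equiv> 2 * v + 9"

definition ready :: "nat \<Rightarrow> (nat \<Rightarrow> nat) \<Rightarrow> bool" where
  "ready n r \<longleftrightarrow> r len_reg = n * n \<and> r size_reg = n \<and> r one_reg = 1 \<and> r zero_reg = 0"

text \<open>
  The registers that the code of a formula at depth \<open>d\<close> leaves unchanged: the four constants and
  those of the variables below \<open>d\<close>.
\<close>

definition protected :: "nat \<Rightarrow> nat set" where
  "protected d = {..<4} \<union> {8..<2 * d + 8}"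

definition agree :: "nat \<Rightarrow> (nat \<Rightarrow> nat) \<Rightarrow> (nat \<Rightarrow> nat) \<Rightarrow> bool" where
  "agree d r r' \<longleftrightarrow> (\<forall>i\<in>protected d. r' i = r i)"

definition env :: "nat \<Rightarrow> (nat \<Rightarrow> nat) \<Rightarrow> nat list" where
  "env d r = map (\<lambda>v. r (val_reg v)) [0..<d]"

lemma agree_refl [simp]: "agree d r r"
  by (simp add: agree_def)

lemma agree_trans: "agree d r r' \<Longrightarrow> agree d r' r'' \<Longrightarrow> agree d r r''"
  by (simp add: agree_def)

lemma agree_mono: "agree d r r' \<Longrightarrow> e \<le> d \<Longrightarrow> agree e r r'"
  by (auto simp: agree_def protected_def)

lemma agree_upd [simp]: "i \<notin> protected d \<Longrightarrow> agree d r (r'(i := k)) \<longleftrightarrow> agree d r r'"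
  by (auto simp: agree_def)

lemma agree_ready: "agree d r r' \<Longrightarrow> ready n r' \<longleftrightarrow> ready n r"
  by (simp add: agree_def ready_def protected_def)

lemma agree_val: "agree d r r' \<Longrightarrow> v < d \<Longrightarrow> r' (val_reg v) = r (val_reg v)"
  by (simp add: agree_def protected_def)

lemma agree_cnt: "agree d r r' \<Longrightarrow> v < d \<Longrightarrow> r' (cnt_reg v) = r (cnt_reg v)"
  by (simp add: agree_def protected_def)

lemma agree_env: "agree d r r' \<Longrightarrow> env d r' = env d r"
  by (simp add: env_def agree_val)

lemma env_Suc: "env (Suc d) r = env d r @ [r (val_reg d)]"
  by (simp add: env_def)

lemma env_2: "env 2 r = [r (val_reg 0), r (val_reg 1)]"
proof -
  have "env 0 r = []" by (simp add: env_def)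
  then show ?thesis using env_Suc[of 1 r, unfolded Suc_1] env_Suc[of 0 r] by simp
qed

lemma env_nth [simp]: "x < d \<Longrightarrow> env d r ! x = r (val_reg x)"
  by (simp add: env_def)

lemma not_protected [simp]:
  "res_reg \<notin> protected d" "ptr_reg \<notin> protected d" "tmp_reg \<notin> protected d"
  "val_reg d \<notin> protected d" "cnt_reg d \<notin> protected d"
  by (auto simp: protected_def)

text \<open>
  The machine cannot multiply, so the address of a matrix cell is computed by repeated addition.
\<close>

definition addr_prog :: "nat \<Rightarrow> nat \<Rightarrow> nat \<Rightarrow> com" where
  "addr_prog b x y = Add ptr_reg b zero_reg ;; Add tmp_reg (val_reg x) zero_reg ;;
     WhileNZ tmp_reg (Add ptr_reg ptr_reg size_reg ;; Sub tmp_reg tmp_reg one_reg) ;;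
     Add ptr_reg ptr_reg (val_reg y)"

lemma runs_addr_prog:
  assumes "ready n r" "r (val_reg x) \<le> n" "b < 4"
  shows "runs (addr_prog b x y) (r, m) (3 * n + 4)
    (\<lambda>(r', m'). m' = m \<and> r' ptr_reg = r b + r (val_reg x) * n + r (val_reg y) \<and> agree d r r')"
proof -
  let ?I = "\<lambda>(r', m'). m' = m \<and> (\<exists>k\<le>r (val_reg x). r' tmp_reg = r (val_reg x) - k \<and>
      r' ptr_reg = r b + k * n) \<and> (\<forall>i. i \<noteq> ptr_reg \<and> i \<noteq> tmp_reg \<longrightarrow> r' i = r i)"
  let ?r = "r(ptr_reg := r b, tmp_reg := r (val_reg x))"
  have loop: "runs (WhileNZ tmp_reg (Add ptr_reg ptr_reg size_reg ;; Sub tmp_reg tmp_reg one_reg))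
      (?r, m) ((\<lambda>(r', m'). r' tmp_reg) (?r, m) * ((1 + 1) + 1) + 1) (\<lambda>s'. ?I s' \<and> fst s' tmp_reg = 0)"
  proof (rule runs_WhileNZ)
    fix s assume I: "?I s" and nz: "fst s tmp_reg \<noteq> 0"
    obtain r1 m1 where s: "s = (r1, m1)" by (cases s)
    from I obtain k where k: "k \<le> r (val_reg x)" "r1 tmp_reg = r (val_reg x) - k" "m1 = m"
      "r1 ptr_reg = r b + k * n" "\<And>i. i \<noteq> ptr_reg \<Longrightarrow> i \<noteq> tmp_reg \<Longrightarrow> r1 i = r i"
      unfolding s by auto
    show "runs (Add ptr_reg ptr_reg size_reg ;; Sub tmp_reg tmp_reg one_reg) s (1 + 1)
      (\<lambda>s'. ?I s' \<and> (\<lambda>(r', m'). r' tmp_reg) s' < (\<lambda>(r', m'). r' tmp_reg) s)"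
      unfolding s
      apply (rule runs_Seq runs_atomic)+
      using k nz assms(1) unfolding s
      by (auto simp: ready_def intro!: exI[of _ "Suc k"])
  qed (auto intro!: exI[of _ 0])
  have eqs: "r b + r zero_reg = r b"
    "(r(ptr_reg := r b)) (val_reg x) + (r(ptr_reg := r b)) zero_reg = r (val_reg x)"
    using assms(1) by (simp_all add: ready_def)
  have "runs (addr_prog b x y) (r, m) (1 + (1 + ((r (val_reg x) * 3 + 1) + 1)))
    (\<lambda>(r', m'). m' = m \<and> r' ptr_reg = r b + r (val_reg x) * n + r (val_reg y) \<and> agree d r r')"
    unfolding addr_prog_def
  proof (rule runs_Seq, rule runs_atomic, rule runs_Seq, rule runs_atomic, unfold eqs, rule runs_Seq,
      rule runs_weaken[OF loop])
    fix s assume I: "?I s \<and> fst s tmp_reg = 0"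
    then obtain r1 where r1: "s = (r1, m)" "r1 ptr_reg = r b + r (val_reg x) * n"
        "\<And>i. i \<noteq> ptr_reg \<Longrightarrow> i \<noteq> tmp_reg \<Longrightarrow> r1 i = r i"
      by (cases s) auto
    show "runs (Add ptr_reg ptr_reg (val_reg y)) s 1
      (\<lambda>(r', m'). m' = m \<and> r' ptr_reg = r b + r (val_reg x) * n + r (val_reg y) \<and> agree d r r')"
      unfolding r1(1) by (rule runs_atomic) (use r1 in \<open>auto simp: agree_def protected_def\<close>)
  qed simp
  then show ?thesis by (rule runs_weaken) (use assms(2) in auto)
qed

lemma runs_load_cell:
  assumes "ready n r" "r (val_reg x) \<le> n" "b < 4"
  shows "runs (addr_prog b x y ;; Load res_reg ptr_reg) (r, m) (3 * n + 5)
    (\<lambda>(r', m'). m' = m \<and> r' res_reg = m (r b + r (val_reg x) * n + r (val_reg y)) \<and> agree d r r')"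
    (is "runs _ _ _ ?Q")
proof -
  have "runs (addr_prog b x y ;; Load res_reg ptr_reg) (r, m) ((3 * n + 4) + 1) ?Q"
  proof (rule runs_Seq, rule runs_weaken[OF runs_addr_prog[OF assms, where d = d] order_refl])
    fix s assume s: "(\<lambda>(r', m'). m' = m \<and> r' ptr_reg = r b + r (val_reg x) * n + r (val_reg y) \<and>
      agree d r r') s"
    obtain r1 m1 where s1: "s = (r1, m1)" by (cases s)
    show "runs (Load res_reg ptr_reg) s 1 ?Q"
      unfolding s1 by (rule runs_atomic) (use s s1 in auto)
  qed
  then show ?thesis by (rule runs_weaken) auto
qed

text \<open>
  The truth value is delivered in \<open>res_reg\<close> as zero or nonzero. A quantifier counts down from \<open>n\<close>; it sets its
  counter to \<open>0\<close> once a witness is found, so that \<open>res_reg\<close> survives the exit from the loop.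
\<close>

primrec compile :: "nat \<Rightarrow> fm \<Rightarrow> com" where
  "compile d (Less x y) = Sub res_reg (val_reg y) (val_reg x)"
| "compile d (Input x y) = addr_prog zero_reg x y ;; Load res_reg ptr_reg"
| "compile d (Removed x y) = addr_prog len_reg x y ;; Load res_reg ptr_reg"
| "compile d (Neg \<phi>) = compile d \<phi> ;; IfNZ res_reg (Const res_reg 0) (Const res_reg 1)"
| "compile d (Conj \<phi> \<psi>) = compile d \<phi> ;; IfNZ res_reg (compile d \<psi>) Skip"
| "compile d (Exists \<phi>) = Const res_reg 0 ;; Add (cnt_reg d) size_reg zero_reg ;;
     WhileNZ (cnt_reg d) (Sub (val_reg d) (cnt_reg d) one_reg ;; compile (Suc d) \<phi> ;;
       IfNZ res_reg (Const (cnt_reg d) 0) (Sub (cnt_reg d) (cnt_reg d) one_reg))"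

primrec check_time :: "fm \<Rightarrow> nat poly" where
  "check_time (Less x y) = [:1:]"
| "check_time (Input x y) = [:5, 3:]"
| "check_time (Removed x y) = [:5, 3:]"
| "check_time (Neg \<phi>) = check_time \<phi> + [:3:]"
| "check_time (Conj \<phi> \<psi>) = check_time \<phi> + check_time \<psi> + [:2:]"
| "check_time (Exists \<phi>) = [:0, 1:] * (check_time \<phi> + [:5:]) + [:3:]"

text \<open>
  The loop invariant of a quantifier: either the last test succeeded, the counter is \<open>0\<close> and
  a witness exists, or no value from the counter upwards is a witness.
\<close>

lemma runs_compile:
  assumes "wf_fm d \<phi>" "ready n r" "\<And>v. v < d \<Longrightarrow> r (val_reg v) < n"
  shows "runs (compile d \<phi>) (r, m) (poly (check_time \<phi>) n)
    (\<lambda>(r', m'). m' = m \<and> (r' res_reg \<noteq> 0 \<longleftrightarrow> holds n m (env d r) \<phi>) \<and> agree d r r')"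
  using assms
proof (induction \<phi> arbitrary: d r)
  case (Less x y)
  have "runs (compile d (Less x y)) (r, m) 1
    (\<lambda>(r', m'). m' = m \<and> (r' res_reg \<noteq> 0 \<longleftrightarrow> holds n m (env d r) (Less x y)) \<and> agree d r r')"
    unfolding compile.simps by (rule runs_atomic) (use Less in auto)
  then show ?case by simp
next
  case (Input x y)
  then have "runs (compile d (Input x y)) (r, m) (3 * n + 5)
    (\<lambda>(r', m'). m' = m \<and> (r' res_reg \<noteq> 0 \<longleftrightarrow> holds n m (env d r) (Input x y)) \<and> agree d r r')"
    unfolding compile.simps
    by (intro runs_weaken[OF runs_load_cell[where d = d and n = n] order_refl])
       (auto simp: less_imp_le ready_def)
  then show ?case by (rule runs_weaken) auto
next
  case (Removed x y)
  then have "runs (compile d (Removed x y)) (r, m) (3 * n + 5)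
    (\<lambda>(r', m'). m' = m \<and> (r' res_reg \<noteq> 0 \<longleftrightarrow> holds n m (env d r) (Removed x y)) \<and> agree d r r')"
    unfolding compile.simps
    by (intro runs_weaken[OF runs_load_cell[where d = d and n = n] order_refl])
       (auto simp: less_imp_le ready_def)
  then show ?case by (rule runs_weaken) auto
next
  case (Neg \<phi>)
  have "runs (compile d (Neg \<phi>)) (r, m) (poly (check_time \<phi>) n + (1 + (1 + 1)))
    (\<lambda>(r', m'). m' = m \<and> (r' res_reg \<noteq> 0 \<longleftrightarrow> holds n m (env d r) (Neg \<phi>)) \<and> agree d r r')"
    unfolding compile.simps
  proof (rule runs_Seq, rule runs_weaken[OF Neg.IH order_refl])
    fix s assume "(\<lambda>(r', m'). m' = m \<and> (r' res_reg \<noteq> 0 \<longleftrightarrow> holds n m (env d r) \<phi>) \<and> agree d r r') s"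
    then obtain r1 where s: "s = (r1, m)" and r1: "r1 res_reg \<noteq> 0 \<longleftrightarrow> holds n m (env d r) \<phi>" "agree d r r1"
      by (cases s) auto
    show "runs (IfNZ res_reg (Const res_reg 0) (Const res_reg 1)) s (1 + (1 + 1))
      (\<lambda>(r', m'). m' = m \<and> (r' res_reg \<noteq> 0 \<longleftrightarrow> holds n m (env d r) (Neg \<phi>)) \<and> agree d r r')"
      unfolding s by (rule runs_IfNZ; rule runs_atomic) (use r1 in auto)
  qed (use Neg.prems in auto)
  then show ?case by (rule runs_weaken) auto
next
  case (Conj \<phi> \<psi>)
  have "runs (compile d (Conj \<phi> \<psi>)) (r, m)
     (poly (check_time \<phi>) n + (1 + (poly (check_time \<psi>) n + 1)))
    (\<lambda>(r', m'). m' = m \<and> (r' res_reg \<noteq> 0 \<longleftrightarrow> holds n m (env d r) (Conj \<phi> \<psi>)) \<and> agree d r r')"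
    unfolding compile.simps
  proof (rule runs_Seq, rule runs_weaken[OF Conj.IH(1) order_refl])
    fix s assume "(\<lambda>(r', m'). m' = m \<and> (r' res_reg \<noteq> 0 \<longleftrightarrow> holds n m (env d r) \<phi>) \<and> agree d r r') s"
    then obtain r1 where s: "s = (r1, m)" and r1: "r1 res_reg \<noteq> 0 \<longleftrightarrow> holds n m (env d r) \<phi>" "agree d r r1"
      by (cases s) auto
    show "runs (IfNZ res_reg (compile d \<psi>) Skip) s (1 + (poly (check_time \<psi>) n + 1))
      (\<lambda>(r', m'). m' = m \<and> (r' res_reg \<noteq> 0 \<longleftrightarrow> holds n m (env d r) (Conj \<phi> \<psi>)) \<and> agree d r r')"
      unfolding s
    proof (rule runs_IfNZ)
      assume nz: "fst (r1, m) res_reg \<noteq> 0"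
      show "runs (compile d \<psi>) (r1, m) (poly (check_time \<psi>) n)
        (\<lambda>(r', m'). m' = m \<and> (r' res_reg \<noteq> 0 \<longleftrightarrow> holds n m (env d r) (Conj \<phi> \<psi>)) \<and> agree d r r')"
      proof (rule runs_weaken[OF Conj.IH(2) order_refl])
        show "ready n r1" using agree_ready[OF r1(2)] Conj.prems(2) by simp
        show "r1 (val_reg v) < n" if "v < d" for v
          using that Conj.prems(3) agree_val[OF r1(2)] by simp
        fix s' assume "(\<lambda>(r', m'). m' = m \<and> (r' res_reg \<noteq> 0 \<longleftrightarrow> holds n m (env d r1) \<psi>) \<and> agree d r1 r') s'"
        then show "(\<lambda>(r', m'). m' = m \<and> (r' res_reg \<noteq> 0 \<longleftrightarrow> holds n m (env d r) (Conj \<phi> \<psi>)) \<and> agree d r r') s'"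
          using r1 nz agree_trans[OF r1(2)] agree_env[OF r1(2)] by auto
      qed (use Conj.prems in auto)
    next
      assume "fst (r1, m) res_reg = 0"
      then show "runs Skip (r1, m) 1
        (\<lambda>(r', m'). m' = m \<and> (r' res_reg \<noteq> 0 \<longleftrightarrow> holds n m (env d r) (Conj \<phi> \<psi>)) \<and> agree d r r')"
        by (intro runs_atomic) (use r1 in auto)
    qed
  qed (use Conj.prems in auto)
  then show ?case by (rule runs_weaken) auto
next
  case (Exists \<phi>)
  let ?T = "1 + (poly (check_time \<phi>) n + (1 + (1 + 1)))"
  let ?body = "Sub (val_reg d) (cnt_reg d) one_reg ;; compile (Suc d) \<phi> ;;
       IfNZ res_reg (Const (cnt_reg d) 0) (Sub (cnt_reg d) (cnt_reg d) one_reg)"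
  let ?P = "\<lambda>a. holds n m (env d r @ [a]) \<phi>"
  let ?I = "\<lambda>(r', m'). m' = m \<and> agree d r r' \<and> r' (cnt_reg d) \<le> n \<and>
     (if r' res_reg \<noteq> 0 then r' (cnt_reg d) = 0 \<and> (\<exists>a<n. ?P a)
      else \<forall>a<n. r' (cnt_reg d) \<le> a \<longrightarrow> \<not> ?P a)"
  let ?r = "r(res_reg := 0, cnt_reg d := n)"
  have loop: "runs (WhileNZ (cnt_reg d) ?body) (?r, m)
     ((\<lambda>(r', m'). r' (cnt_reg d)) (?r, m) * (?T + 1) + 1) (\<lambda>s'. ?I s' \<and> fst s' (cnt_reg d) = 0)"
  proof (rule runs_WhileNZ)
    show "?I (?r, m)" by simp
    fix s assume I: "?I s" and nz: "fst s (cnt_reg d) \<noteq> 0"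
    obtain r1 where s: "s = (r1, m)" and r1: "agree d r r1" "r1 (cnt_reg d) \<le> n" "r1 (cnt_reg d) > 0"
       "\<And>a. a < n \<Longrightarrow> r1 (cnt_reg d) \<le> a \<Longrightarrow> \<not> ?P a"
      using I nz by (cases s) (auto split: if_splits)
    define k where "k = r1 (cnt_reg d) - 1"
    have k: "r1 (cnt_reg d) = Suc k" "k < n" using r1 by (auto simp: k_def)
    let ?r1 = "r1(val_reg d := k)"
    have rd: "ready n r1" using Exists.prems(2) agree_ready[OF r1(1)] by simp
    have ag: "agree d r ?r1" using r1(1) by simp
    have env1: "env (Suc d) ?r1 = env d r @ [k]" using agree_env[OF ag] by (simp add: env_Suc)
    have b: "runs (compile (Suc d) \<phi>) (?r1, m) (poly (check_time \<phi>) n)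
        (\<lambda>(r', m'). m' = m \<and> (r' res_reg \<noteq> 0 \<longleftrightarrow> ?P k) \<and> agree (Suc d) ?r1 r')"
      unfolding env1[symmetric]
    proof (rule Exists.IH)
      show "ready n ?r1" using agree_ready[OF ag] Exists.prems(2) by simp
      show "?r1 (val_reg v) < n" if "v < Suc d" for v
        using that k Exists.prems(3) agree_val[OF ag] by (cases "v = d") auto
    qed (use Exists.prems(1) in simp)
    have sub: "r1 (cnt_reg d) - r1 one_reg = k" using rd k by (simp add: ready_def)
    show "runs ?body s ?T (\<lambda>s'. ?I s' \<and> (\<lambda>(r', m'). r' (cnt_reg d)) s' < (\<lambda>(r', m'). r' (cnt_reg d)) s)"
      unfolding s
    proof (rule runs_Seq, rule runs_atomic, unfold sub, rule runs_Seq, rule runs_weaken[OF b order_refl])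
      fix s2 assume "(\<lambda>(r', m'). m' = m \<and> (r' res_reg \<noteq> 0 \<longleftrightarrow> ?P k) \<and> agree (Suc d) ?r1 r') s2"
      then obtain r2 where s2: "s2 = (r2, m)" and r2: "r2 res_reg \<noteq> 0 \<longleftrightarrow> ?P k" "agree (Suc d) ?r1 r2"
        by (cases s2) auto
      have "agree d ?r1 r2" using r2(2) by (rule agree_mono) simp
      then have ag2: "agree d r r2" using ag agree_trans by blast
      have c2: "r2 (cnt_reg d) = Suc k" using agree_cnt[OF r2(2), of d] k by simp
      have o2: "r2 one_reg = 1" using agree_ready[OF ag2, of n] Exists.prems(2) by (simp add: ready_def)
      show "runs (IfNZ res_reg (Const (cnt_reg d) 0) (Sub (cnt_reg d) (cnt_reg d) one_reg)) s2
         (1 + (1 + 1)) (\<lambda>s'. ?I s' \<and> (\<lambda>(r', m'). r' (cnt_reg d)) s' < (\<lambda>(r', m'). r' (cnt_reg d)) (r1, m))"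
        unfolding s2
      proof (rule runs_IfNZ)
        assume "fst (r2, m) res_reg \<noteq> 0"
        then show "runs (Const (cnt_reg d) 0) (r2, m) 1 (\<lambda>s'. ?I s' \<and>
          (\<lambda>(r', m'). r' (cnt_reg d)) s' < (\<lambda>(r', m'). r' (cnt_reg d)) (r1, m))"
          using k r2(1) ag2 by (intro runs_atomic) auto
      next
        assume "fst (r2, m) res_reg = 0"
        then show "runs (Sub (cnt_reg d) (cnt_reg d) one_reg) (r2, m) 1 (\<lambda>s'. ?I s' \<and>
          (\<lambda>(r', m'). r' (cnt_reg d)) s' < (\<lambda>(r', m'). r' (cnt_reg d)) (r1, m))"
          using k r2(1) ag2 c2 o2 r1(4) 
          by (intro runs_atomic) (auto, metis Suc_leI le_neq_implies_less)
      qed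
    qed
  qed
  have init: "(r(res_reg := 0)) size_reg + (r(res_reg := 0)) zero_reg = n"
    using Exists.prems(2) by (simp add: ready_def)
  have "runs (compile d (Exists \<phi>)) (r, m) (1 + (1 + (n * (?T + 1) + 1)))
    (\<lambda>(r', m'). m' = m \<and> (r' res_reg \<noteq> 0 \<longleftrightarrow> holds n m (env d r) (Exists \<phi>)) \<and> agree d r r')"
    unfolding compile.simps
  proof (rule runs_Seq, rule runs_atomic, rule runs_Seq, rule runs_atomic, unfold init, rule runs_weaken[OF loop])
    show "(\<lambda>(r', m'). m' = m \<and> (r' res_reg \<noteq> 0 \<longleftrightarrow> holds n m (env d r) (Exists \<phi>)) \<and> agree d r r') s'"
      if "?I s' \<and> fst s' (cnt_reg d) = 0" for s'
      using that by (auto split: if_splits)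
  qed simp
  then show ?case by (rule runs_weaken) (auto simp: algebra_simps)
qed

section \<open>Greedy deletion of matrix cells\<close>

definition for_prog :: "nat \<Rightarrow> com \<Rightarrow> com" where
  "for_prog v body = Add (cnt_reg v) size_reg zero_reg ;;
     WhileNZ (cnt_reg v) (Sub (val_reg v) (cnt_reg v) one_reg ;; body ;;
       Sub (cnt_reg v) (cnt_reg v) one_reg)"

text \<open>
  The invariant \<open>J k\<close> describes the memory when the values from \<open>k\<close> upwards have been processed.
\<close>

lemma runs_for_prog:
  fixes J :: "nat \<Rightarrow> (nat \<Rightarrow> nat) \<Rightarrow> bool"
  assumes r: "ready n r" and J: "J n m"
    and body: "\<And>k r' m'. k < n \<Longrightarrow> agree v r r' \<Longrightarrow> r' (val_reg v) = k \<Longrightarrow> J (Suc k) m' \<Longrightarrow>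
      runs body (r', m') T (\<lambda>(r'', m''). J k m'' \<and> agree (Suc v) r' r'')"
  shows "runs (for_prog v body) (r, m) (n * (T + 3) + 2) (\<lambda>(r', m'). J 0 m' \<and> agree v r r')"
proof -
  let ?I = "\<lambda>(r', m'). J (r' (cnt_reg v)) m' \<and> r' (cnt_reg v) \<le> n \<and> agree v r r'"
  let ?r = "r(cnt_reg v := n)"
  have loop: "runs (WhileNZ (cnt_reg v) (Sub (val_reg v) (cnt_reg v) one_reg ;; body ;;
       Sub (cnt_reg v) (cnt_reg v) one_reg)) (?r, m)
     ((\<lambda>(r', m'). r' (cnt_reg v)) (?r, m) * ((1 + (T + 1)) + 1) + 1)
     (\<lambda>s'. ?I s' \<and> fst s' (cnt_reg v) = 0)"
  proof (rule runs_WhileNZ)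
    show "?I (?r, m)" using J by simp
    fix s assume I: "?I s" and nz: "fst s (cnt_reg v) \<noteq> 0"
    obtain r1 m1 where s: "s = (r1, m1)" by (cases s)
    define k where "k = r1 (cnt_reg v) - 1"
    have k: "r1 (cnt_reg v) = Suc k" "k < n" "J (Suc k) m1" "agree v r r1"
      using I nz by (auto simp: k_def s)
    let ?r1 = "r1(val_reg v := k)"
    have sub: "r1 (cnt_reg v) - r1 one_reg = k"
      using agree_ready[OF k(4), of n] r k(1) by (simp add: ready_def)
    have ag: "agree v r ?r1" using k(4) by simp
    show "runs (Sub (val_reg v) (cnt_reg v) one_reg ;; body ;; Sub (cnt_reg v) (cnt_reg v) one_reg)
        s (1 + (T + 1)) (\<lambda>s'. ?I s' \<and> (\<lambda>(r', m'). r' (cnt_reg v)) s' < (\<lambda>(r', m'). r' (cnt_reg v)) s)"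
      unfolding s
    proof (rule runs_Seq, rule runs_atomic, unfold sub, rule runs_Seq, rule runs_weaken[OF body order_refl])
      show "k < n" "agree v r ?r1" "?r1 (val_reg v) = k" "J (Suc k) m1" using k ag by simp_all
      fix s2 assume "(\<lambda>(r'', m''). J k m'' \<and> agree (Suc v) ?r1 r'') s2"
      then obtain r2 m2 where s2: "s2 = (r2, m2)" and r2: "J k m2" "agree (Suc v) ?r1 r2"
        by (cases s2) auto
      have c2: "r2 (cnt_reg v) = Suc k" using agree_cnt[OF r2(2), of v] k by simp
      have "agree v ?r1 r2" using r2(2) by (rule agree_mono) simp
      then have ag2: "agree v r r2" using ag agree_trans by blast
      have o2: "r2 one_reg = 1" using agree_ready[OF ag2, of n] r by (simp add: ready_def)
      show "runs (Sub (cnt_reg v) (cnt_reg v) one_reg) s2 1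
        (\<lambda>s'. ?I s' \<and> (\<lambda>(r', m'). r' (cnt_reg v)) s' < (\<lambda>(r', m'). r' (cnt_reg v)) (r1, m1))"
        unfolding s2 by (rule runs_atomic) (use r2 c2 o2 ag2 k in auto)
    qed
  qed
  have init: "r size_reg + r zero_reg = n" using r by (simp add: ready_def)
  have "runs (for_prog v body) (r, m) (1 + (n * ((1 + (T + 1)) + 1) + 1)) (\<lambda>(r', m'). J 0 m' \<and> agree v r r')"
    unfolding for_prog_def
  proof (rule runs_Seq, rule runs_atomic, unfold init, rule runs_weaken[OF loop])
    show "(\<lambda>(r', m'). J 0 m' \<and> agree v r r') s'" if "?I s' \<and> fst s' (cnt_reg v) = 0" for s'
      using that by auto
  qed simp
  then show ?thesis by (rule runs_weaken) (auto simp: algebra_simps)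
qed

definition cells :: "nat \<Rightarrow> (nat \<times> nat) set" where
  "cells n = {..<n} \<times> {..<n}"

lemma cells_iff [simp]: "(i, j) \<in> cells n \<longleftrightarrow> i < n \<and> j < n"
  by (simp add: cells_def)

text \<open>
  Here the invariant is indexed by the set of processed cells. All the body has to know about the order of
  traversal is that its cell is new.
\<close>

lemma runs_for_cells:
  fixes J :: "(nat \<times> nat) set \<Rightarrow> (nat \<Rightarrow> nat) \<Rightarrow> bool"
  assumes r: "ready n r" and J: "J {} m"
    and body: "\<And>i j S r' m'. i < n \<Longrightarrow> j < n \<Longrightarrow> ready n r' \<Longrightarrow> env 2 r' = [i, j] \<Longrightarrow>
      S \<subseteq> cells n \<Longrightarrow> (i, j) \<notin> S \<Longrightarrow> J S m' \<Longrightarrow>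
      runs body (r', m') T (\<lambda>(r'', m''). J (insert (i, j) S) m'' \<and> agree 2 r' r'')"
  shows "runs (for_prog 0 (for_prog 1 body)) (r, m) (n * (n * (T + 3) + 2 + 3) + 2)
    (\<lambda>(r', m'). J (cells n) m' \<and> ready n r')"
proof -
  let ?rows = "\<lambda>i. {i..<n} \<times> {..<n}"
  have "runs (for_prog 0 (for_prog 1 body)) (r, m) (n * ((n * (T + 3) + 2) + 3) + 2)
    (\<lambda>(r', m'). J (?rows 0) m' \<and> agree 0 r r')"
  proof (rule runs_for_prog[OF r])
    show "J (?rows n) m" using J by simp
    fix i r1 m1
    assume i: "i < n" and r1: "agree 0 r r1" "r1 (val_reg 0) = i" and J1: "J (?rows (Suc i)) m1"
    have rd1: "ready n r1" using agree_ready[OF r1(1)] r by simp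
    let ?S = "\<lambda>j. ?rows (Suc i) \<union> {i} \<times> {j..<n}"
    have "runs (for_prog 1 body) (r1, m1) (n * (T + 3) + 2) (\<lambda>(r', m'). J (?S 0) m' \<and> agree 1 r1 r')"
    proof (rule runs_for_prog[OF rd1])
      show "J (?S n) m1" using J1 by simp
      fix j r2 m2
      assume j: "j < n" and r2: "agree 1 r1 r2" "r2 (val_reg 1) = j" and J2: "J (?S (Suc j)) m2"
      have rd2: "ready n r2" using agree_ready[OF r2(1)] rd1 by simp
      have "r2 (val_reg 0) = i" using agree_val[OF r2(1), of 0] r1 by simp
      then have env2: "env 2 r2 = [i, j]" using r2(2) by (simp only: env_2)
      have S: "insert (i, j) (?S (Suc j)) = ?S j" using j by auto
      have "?S (Suc j) \<subseteq> cells n" "(i, j) \<notin> ?S (Suc j)" using i j by auto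
      from body[OF i j rd2 env2 this J2]
      show "runs body (r2, m2) T (\<lambda>(r'', m''). J (?S j) m'' \<and> agree (Suc 1) r2 r'')"
        unfolding S Suc_1 .
    qed
    moreover have "?S 0 = ?rows i" using i by auto
    ultimately show "runs (for_prog 1 body) (r1, m1) (n * (T + 3) + 2)
       (\<lambda>(r'', m''). J (?rows i) m'' \<and> agree (Suc 0) r1 r'')" unfolding One_nat_def by (simp only:)
  qed
  then show ?thesis
  proof (rule runs_weaken)
    fix s assume s: "(\<lambda>(r', m'). J (?rows 0) m' \<and> agree 0 r r') s"
    obtain r1 m1 where "s = (r1, m1)" by (cases s)
    with s have "J (?rows 0) m1" "agree 0 r r1" by auto
    then show "(\<lambda>(r', m'). J (cells n) m' \<and> ready n r') s"
      using agree_ready[of 0 r r1 n] r \<open>s = (r1, m1)\<close> by (simp add: cells_def lessThan_atLeast0)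
  qed simp
qed

lemma cell_eq_iff: "j < n \<Longrightarrow> j' < n \<Longrightarrow> i * n + j = i' * n + j' \<longleftrightarrow> i = i' \<and> j = (j' :: nat)"
  by (metis add.commute add_0 div_less div_mult_self3 less_nat_zero_code mod_less mod_mult_self3)

lemma cell_less:
  assumes "i < k" "j < (n :: nat)"
  shows "i * n + j < k * n"
proof -
  have "i * n + j < Suc i * n" using assms(2) by simp
  also have "\<dots> \<le> k * n" using assms(1) by (intro mult_right_mono) auto
  finally show ?thesis .
qed

definition write_prog :: "nat \<Rightarrow> nat \<Rightarrow> com" where
  "write_prog b c = addr_prog b 0 1 ;; Store ptr_reg c"

lemma runs_write_prog:
  assumes "ready n r" "env 2 r = [i, j]" "i < n" "b < 4" "c < 4"
  shows "runs (write_prog b c) (r, m) (3 * n + 5)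
    (\<lambda>(r', m'). m' = m(r b + i * n + j := r c) \<and> agree 2 r r')"
proof -
  have ij: "r (val_reg 0) = i" "r (val_reg 1) = j" using assms(2) by (simp_all only: env_2 list.inject)
  have "runs (write_prog b c) (r, m) ((3 * n + 4) + 1)
    (\<lambda>(r', m'). m' = m(r b + i * n + j := r c) \<and> agree 2 r r')"
    unfolding write_prog_def
  proof (rule runs_Seq, rule runs_weaken[OF runs_addr_prog[OF assms(1) _ assms(4), where d = 2] order_refl])
    show "r (val_reg 0) \<le> n" using ij assms(3) by simp
    fix s assume s: "(\<lambda>(r', m'). m' = m \<and> r' ptr_reg = r b + r (val_reg 0) * n + r (val_reg 1) \<and>
      agree 2 r r') s"
    obtain r1 where s1: "s = (r1, m)" and r1: "r1 ptr_reg = r b + i * n + j" "agree 2 r r1"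
      using s unfolding ij by (cases s) auto
    have "r1 c = r c" using r1(2) assms(5) by (simp add: agree_def protected_def)
    then show "runs (Store ptr_reg c) s 1 (\<lambda>(r', m'). m' = m(r b + i * n + j := r c) \<and> agree 2 r r')"
      unfolding s1 using r1 by (intro runs_atomic) simp
  qed
  then show ?thesis by (rule runs_weaken) auto
qed

text \<open>
  \<open>D\<close> is the set of cells still present, so the cells outside \<open>D\<close> are the ones marked as removed.
\<close>

definition graph_mem :: "nat \<Rightarrow> bool list \<Rightarrow> (nat \<times> nat) set \<Rightarrow> nat \<Rightarrow> nat" where
  "graph_mem n x D a =
     (if a < n * n then of_bool (x ! a)
      else of_bool (\<exists>i j. (i, j) \<in> cells n - D \<and> a = n * n + i * n + j))"

lemma graph_mem_input:
  "i < n \<Longrightarrow> j < n \<Longrightarrow> graph_mem n x D (i * n + j) = of_bool (x ! (i * n + j))"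
  by (simp add: graph_mem_def cell_less)

lemma graph_mem_removed:
  assumes "i < n" "j < n"
  shows "graph_mem n x D (n * n + i * n + j) = of_bool ((i, j) \<notin> D)"
proof -
  have "(\<exists>i' j'. (i', j') \<in> cells n - D \<and> n * n + i * n + j = n * n + i' * n + j') \<longleftrightarrow> (i, j) \<notin> D"
  proof
    assume "\<exists>i' j'. (i', j') \<in> cells n - D \<and> n * n + i * n + j = n * n + i' * n + j'"
    then obtain i' j' where "i' < n" "j' < n" "(i', j') \<notin> D" "i * n + j = i' * n + j'" by auto
    then show "(i, j) \<notin> D" using cell_eq_iff[of j n j' i i'] assms by simp
  qed (use assms in auto)
  then show ?thesis by (simp add: graph_mem_def)
qed

lemma graph_mem_update:
  assumes "i < n" "j < n"
  shows "(graph_mem n x D)(n * n + i * n + j := of_bool b) =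
    graph_mem n x (if b then D - {(i, j)} else insert (i, j) D)"
    (is "?l = ?r")
proof
  fix a
  show "?l a = ?r a"
  proof (cases "\<exists>i' j'. i' < n \<and> j' < n \<and> a = n * n + i' * n + j'")
    case True
    then obtain i' j' where a: "i' < n" "j' < n" "a = n * n + i' * n + j'" by blast
    have "n * n + i' * n + j' = n * n + i * n + j \<longleftrightarrow> i' = i \<and> j' = j"
      using cell_eq_iff[of j' n j i' i] a assms by simp
    then show ?thesis unfolding a(3) by (simp add: graph_mem_removed a assms)
  next
    case False
    then show ?thesis using assms by (auto simp: graph_mem_def)
  qed
qed

definition greedy_body :: "fm \<Rightarrow> com" where
  "greedy_body \<phi> = write_prog len_reg one_reg ;; compile 2 \<phi> ;;
     IfNZ res_reg Skip (write_prog len_reg zero_reg)"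

definition output_body :: "fm \<Rightarrow> com" where
  "output_body \<psi> = compile 2 \<psi> ;;
     IfNZ res_reg (write_prog zero_reg one_reg) (write_prog zero_reg zero_reg)"

text \<open>
  Finds \<open>n\<close> from the input length \<open>n\<^sup>2\<close> by adding successive odd numbers.
\<close>

definition sqrt_prog :: com where
  "sqrt_prog = Const one_reg 1 ;; Sub ptr_reg len_reg tmp_reg ;;
     WhileNZ ptr_reg (Add tmp_reg tmp_reg size_reg ;; Add tmp_reg tmp_reg size_reg ;;
       Add tmp_reg tmp_reg one_reg ;; Add size_reg size_reg one_reg ;; Sub ptr_reg len_reg tmp_reg)"

definition greedy_prog :: "fm \<Rightarrow> fm \<Rightarrow> com" where
  "greedy_prog \<phi> \<psi> = sqrt_prog ;; for_prog 0 (for_prog 1 (greedy_body \<phi>)) ;;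
     for_prog 0 (for_prog 1 (output_body \<psi>))"

lemma runs_sqrt_prog:
  assumes "length x = n * n"
  shows "runs sqrt_prog (input_state x) (6 * n + 3) (\<lambda>(r, m). ready n r \<and> m = graph_mem n x (cells n))"
proof -
  have m: "snd (input_state x) = graph_mem n x (cells n)"
    by (simp add: input_state_def graph_mem_def assms fun_eq_iff)
  let ?r = "\<lambda>i. if i = len_reg then n * n else if i = one_reg then 1 else if i = ptr_reg then n * n else 0"
  let ?body = "Add tmp_reg tmp_reg size_reg ;; Add tmp_reg tmp_reg size_reg ;;
       Add tmp_reg tmp_reg one_reg ;; Add size_reg size_reg one_reg ;; Sub ptr_reg len_reg tmp_reg"
  let ?m = "graph_mem n x (cells n)"
  let ?I = "\<lambda>(r, m). m = ?m \<and> r len_reg = n * n \<and> r one_reg = 1 \<and> r zero_reg = 0 \<and> r size_reg \<le> n \<and>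
     r tmp_reg = r size_reg * r size_reg \<and> r ptr_reg = n * n - r size_reg * r size_reg"
  have loop: "runs (WhileNZ ptr_reg ?body) (?r, ?m)
    ((\<lambda>(r, m). n - r size_reg) (?r, ?m) * ((1 + (1 + (1 + (1 + 1)))) + 1) + 1) (\<lambda>s. ?I s \<and> fst s ptr_reg = 0)"
  proof (rule runs_WhileNZ)
    fix s assume I: "?I s" and nz: "fst s ptr_reg \<noteq> 0"
    obtain r1 m1 where s: "s = (r1, m1)" by (cases s)
    have r1: "m1 = ?m" "r1 len_reg = n * n" "r1 one_reg = 1" "r1 zero_reg = 0" "r1 size_reg \<le> n"
      "r1 tmp_reg = r1 size_reg * r1 size_reg" "r1 ptr_reg = n * n - r1 size_reg * r1 size_reg"
      using I by (simp_all add: s)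
    have lt: "r1 size_reg < n" using nz r1 by (cases "r1 size_reg = n") (auto simp: s)
    show "runs ?body s (1 + (1 + (1 + (1 + 1))))
      (\<lambda>s'. ?I s' \<and> (\<lambda>(r, m). n - r size_reg) s' < (\<lambda>(r, m). n - r size_reg) s)"
      unfolding s by (rule runs_Seq runs_atomic)+ (use r1 lt in \<open>auto simp: algebra_simps\<close>)
  qed simp
  obtain r0 where s0: "input_state x = (r0, ?m)" "r0 = (\<lambda>_. 0)(0 := n * n)"
    using m by (simp add: input_state_def assms)
  have init: "(r0(one_reg := 1))(ptr_reg := (r0(one_reg := 1)) len_reg - (r0(one_reg := 1)) tmp_reg) = ?r"
    by (auto simp: s0(2))
  have "runs sqrt_prog (input_state x) (1 + (1 + (n * 6 + 1))) (\<lambda>(r, m). ready n r \<and> m = ?m)"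
    unfolding sqrt_prog_def s0(1)
  proof (rule runs_Seq, rule runs_atomic, rule runs_Seq, rule runs_atomic, unfold init, rule runs_weaken[OF loop])
    fix s assume s: "?I s \<and> fst s ptr_reg = 0"
    obtain r1 m1 where s1: "s = (r1, m1)" by (cases s)
    have "n * n \<le> r1 size_reg * r1 size_reg" "r1 size_reg \<le> n" using s by (auto simp: s1)
    then have "r1 size_reg = n" using mult_strict_mono'[of "r1 size_reg" n "r1 size_reg" n] by linarith
    then show "(\<lambda>(r, m). ready n r \<and> m = ?m) s" using s by (simp add: s1 ready_def)
  qed simp
  then show ?thesis by (rule runs_weaken) auto
qed

text \<open>
  The invariant says that no processed cell that is still present can be removed. Later removals
  preserve this because \<open>P\<close> is upward closed.
\<close>

lemma runs_greedy_loop: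
  assumes r: "ready n r" and wf: "wf_fm 2 \<phi>"
    and P: "\<And>D i j. D \<subseteq> cells n \<Longrightarrow> i < n \<Longrightarrow> j < n \<Longrightarrow>
      holds n (graph_mem n x D) [i, j] \<phi> \<longleftrightarrow> P D"
    and mono: "\<And>D D'. P D \<Longrightarrow> D \<subseteq> D' \<Longrightarrow> D' \<subseteq> cells n \<Longrightarrow> P D'"
    and full: "P (cells n)"
  shows "runs (for_prog 0 (for_prog 1 (greedy_body \<phi>))) (r, graph_mem n x (cells n))
    (n * (n * ((6 * n + poly (check_time \<phi>) n + 12) + 3) + 2 + 3) + 2)
    (\<lambda>(r', m'). (\<exists>D\<subseteq>cells n. m' = graph_mem n x D \<and> P D \<and> (\<forall>c\<in>D. \<not> P (D - {c}))) \<and> ready n r')"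
proof -
  define J where "J S m \<longleftrightarrow> (\<exists>D\<subseteq>cells n. m = graph_mem n x D \<and> cells n - S \<subseteq> D \<and> P D \<and>
    (\<forall>c\<in>S \<inter> D. \<not> P (D - {c})))" for S m
  have "runs (for_prog 0 (for_prog 1 (greedy_body \<phi>))) (r, graph_mem n x (cells n))
    (n * (n * ((6 * n + poly (check_time \<phi>) n + 12) + 3) + 2 + 3) + 2)
    (\<lambda>(r', m'). J (cells n) m' \<and> ready n r')"
  proof (rule runs_for_cells[OF r])
    show "J {} (graph_mem n x (cells n))" unfolding J_def using full by blast
  next
    fix i j S r1 m1
    assume ij: "i < n" "j < n" and r1: "ready n r1" "env 2 r1 = [i, j]"
      and S: "S \<subseteq> cells n" "(i, j) \<notin> S" and J: "J S m1"
    obtain D where D: "D \<subseteq> cells n" "m1 = graph_mem n x D" "cells n - S \<subseteq> D" "P D"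
      "\<And>c. c \<in> S \<Longrightarrow> c \<in> D \<Longrightarrow> \<not> P (D - {c})"
      using J unfolding J_def by blast
    let ?c = "(i, j)"
    let ?D = "D - {?c}"
    have cD: "?c \<in> D" using ij S D(3) by auto
    have D': "?D \<subseteq> cells n" using D(1) by blast
    have rv: "r1 len_reg = n * n" "r1 one_reg = 1" "r1 zero_reg = 0" using r1(1) by (simp_all add: ready_def)
    have upd: "m1(r1 len_reg + i * n + j := r1 one_reg) = graph_mem n x ?D"
      using graph_mem_update[OF ij, of x D True] by (simp add: D(2) rv)
    have "runs (greedy_body \<phi>) (r1, m1)
       ((3 * n + 5) + (poly (check_time \<phi>) n + (1 + (1 + (3 * n + 5)))))
       (\<lambda>(r'', m''). J (insert (i, j) S) m'' \<and> agree 2 r1 r'')"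
      unfolding greedy_body_def
    proof (rule runs_Seq, rule runs_weaken[OF runs_write_prog[OF r1 ij(1)] order_refl])
      fix s2 assume "(\<lambda>(r', m'). m' = m1(r1 len_reg + i * n + j := r1 one_reg) \<and> agree 2 r1 r') s2"
      then obtain r2 where s2: "s2 = (r2, graph_mem n x ?D)" and r2: "agree 2 r1 r2"
        by (cases s2) (auto simp only: upd)
      have rd2: "ready n r2" "env 2 r2 = [i, j]" using agree_ready[OF r2] agree_env[OF r2] r1 by auto
      have v2: "r2 (val_reg v) < n" if "v < 2" for v
        using that rd2(2) ij unfolding env_2 by (cases "v = 0") (auto simp: less_2_cases_iff)
      show "runs (compile 2 \<phi> ;; IfNZ res_reg Skip (write_prog len_reg zero_reg)) s2
         (poly (check_time \<phi>) n + (1 + (1 + (3 * n + 5))))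
         (\<lambda>(r'', m''). J (insert (i, j) S) m'' \<and> agree 2 r1 r'')"
        unfolding s2
      proof (rule runs_Seq, rule runs_weaken[OF runs_compile[OF wf rd2(1) v2] order_refl])
        fix s3 assume "(\<lambda>(r', m'). m' = graph_mem n x ?D \<and>
          (r' res_reg \<noteq> 0 \<longleftrightarrow> holds n (graph_mem n x ?D) (env 2 r2) \<phi>) \<and> agree 2 r2 r') s3"
        then obtain r3 where s3: "s3 = (r3, graph_mem n x ?D)" and
          r3: "r3 res_reg \<noteq> 0 \<longleftrightarrow> P ?D" "agree 2 r2 r3"
          using P[OF D' ij] rd2(2) by (cases s3) auto
        have ag3: "agree 2 r1 r3" using r2 r3(2) agree_trans by blast
        have rd3: "ready n r3" "env 2 r3 = [i, j]" using agree_ready[OF ag3] agree_env[OF ag3] r1 by auto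
        show "runs (IfNZ res_reg Skip (write_prog len_reg zero_reg)) s3 (1 + (1 + (3 * n + 5)))
           (\<lambda>(r'', m''). J (insert (i, j) S) m'' \<and> agree 2 r1 r'')"
          unfolding s3
        proof (rule runs_IfNZ)
          assume "fst (r3, graph_mem n x ?D) res_reg \<noteq> 0"
          then have PD: "P ?D" using r3(1) by simp
          \<comment> \<open>Upward closure: a removal that is possible now was possible when \<open>c\<close> was processed.\<close>
          have "\<not> P (?D - {c})" if "c \<in> insert ?c S" "c \<in> ?D" for c
          proof
            assume "P (?D - {c})"
            moreover have "?D - {c} \<subseteq> D - {c}" "D - {c} \<subseteq> cells n" using D(1) by auto
            ultimately have "P (D - {c})" by (rule mono)
            then show False using D(5)[of c] that by blast
          qed
          then have "J (insert ?c S) (graph_mem n x ?D)"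
            unfolding J_def using PD D' D(3) by (intro exI[of _ ?D]) blast
          then show "runs Skip (r3, graph_mem n x ?D) 1
             (\<lambda>(r'', m''). J (insert (i, j) S) m'' \<and> agree 2 r1 r'')"
            by (intro runs_atomic) (simp add: ag3)
        next
          assume "fst (r3, graph_mem n x ?D) res_reg = 0"
          then have PD: "\<not> P ?D" using r3(1) by simp
          have "insert ?c ?D = D" using cD by blast
          moreover have "r3 len_reg = n * n" "r3 zero_reg = 0" using rd3(1) by (simp_all add: ready_def)
          ultimately have upd3: "(graph_mem n x ?D)(r3 len_reg + i * n + j := r3 zero_reg) = graph_mem n x D"
            using graph_mem_update[OF ij, of x ?D False] by simp
          have J': "J (insert ?c S) (graph_mem n x D)"
            unfolding J_def using PD D(1,3,4,5) by (intro exI[of _ D]) blast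
          show "runs (write_prog len_reg zero_reg) (r3, graph_mem n x ?D) (3 * n + 5)
             (\<lambda>(r'', m''). J (insert (i, j) S) m'' \<and> agree 2 r1 r'')"
            by (rule runs_weaken[OF runs_write_prog[OF rd3 ij(1)] order_refl])
               (use J' ag3 in \<open>auto simp: upd3 intro: agree_trans\<close>)
        qed
      qed
    qed simp_all
    then show "runs (greedy_body \<phi>) (r1, m1) (6 * n + poly (check_time \<phi>) n + 12)
       (\<lambda>(r'', m''). J (insert (i, j) S) m'' \<and> agree 2 r1 r'')"
      by (rule runs_weaken) auto
  qed
  then show ?thesis
  proof (rule runs_weaken)
    fix s assume s: "(\<lambda>(r', m'). J (cells n) m' \<and> ready n r') s"
    obtain r1 m1 where s1: "s = (r1, m1)" by (cases s)
    obtain D where "D \<subseteq> cells n" "m1 = graph_mem n x D" "P D" "\<forall>c\<in>cells n \<inter> D. \<not> P (D - {c})"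
      using s unfolding s1 J_def by auto
    moreover from this(1,4) have "\<forall>c\<in>D. \<not> P (D - {c})" by blast
    ultimately show "(\<lambda>(r', m'). (\<exists>D\<subseteq>cells n. m' = graph_mem n x D \<and> P D \<and>
        (\<forall>c\<in>D. \<not> P (D - {c}))) \<and> ready n r') s"
      using s unfolding s1 by auto
  qed simp
qed

text \<open>
  The output overwrites the input matrix, so \<open>\<psi>\<close> has to be determined by the matrix of removed cells alone.
\<close>

lemma runs_output_loop:
  assumes r: "ready n r" and wf: "wf_fm 2 \<psi>"
    and Q: "\<And>m i j. (\<And>k l. k < n \<Longrightarrow> l < n \<Longrightarrow> m (n * n + k * n + l) = of_bool ((k, l) \<notin> D)) \<Longrightarrow>
      i < n \<Longrightarrow> j < n \<Longrightarrow> holds n m [i, j] \<psi> \<longleftrightarrow> Q i j"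
  shows "runs (for_prog 0 (for_prog 1 (output_body \<psi>))) (r, graph_mem n x D)
    (n * (n * ((6 * n + poly (check_time \<psi>) n + 11) + 3) + 2 + 3) + 2)
    (\<lambda>(r', m'). (\<forall>i<n. \<forall>j<n. m' (i * n + j) = of_bool (Q i j)) \<and> ready n r')"
proof -
  define J where "J S m \<longleftrightarrow> (\<forall>k<n. \<forall>l<n. m (n * n + k * n + l) = of_bool ((k, l) \<notin> D)) \<and>
    (\<forall>k l. (k, l) \<in> S \<longrightarrow> m (k * n + l) = of_bool (Q k l))" for S and m :: "nat \<Rightarrow> nat"
  have "runs (for_prog 0 (for_prog 1 (output_body \<psi>))) (r, graph_mem n x D)
    (n * (n * ((6 * n + poly (check_time \<psi>) n + 11) + 3) + 2 + 3) + 2)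
    (\<lambda>(r', m'). J (cells n) m' \<and> ready n r')"
  proof (rule runs_for_cells[OF r])
    show "J {} (graph_mem n x D)" by (simp add: J_def graph_mem_removed)
  next
    fix i j S r1 m1
    assume ij: "i < n" "j < n" and r1: "ready n r1" "env 2 r1 = [i, j]"
      and S: "S \<subseteq> cells n" and J: "J S m1"
    have v1: "r1 (val_reg v) < n" if "v < 2" for v
      using that r1(2) ij unfolding env_2 by (cases "v = 0") (auto simp: less_2_cases_iff)
    have ev: "holds n m1 (env 2 r1) \<psi> \<longleftrightarrow> Q i j"
      unfolding r1(2) by (rule Q[OF _ ij]) (use J in \<open>simp add: J_def\<close>)
    have J': "J (insert (i, j) S) (m1(i * n + j := of_bool (Q i j)))"
    proof -
      have "n * n + k * n + l \<noteq> i * n + j" for k l using cell_less[OF ij] by simp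
      moreover have "k * n + l = i * n + j \<longleftrightarrow> k = i \<and> l = j" if "(k, l) \<in> insert (i, j) S" for k l
        using cell_eq_iff[of l n j k i] that S ij by auto
      ultimately show ?thesis using J unfolding J_def by auto
    qed
    have w: "runs (write_prog zero_reg c) (r2, m1) (3 * n + 5)
        (\<lambda>(r'', m''). J (insert (i, j) S) m'' \<and> agree 2 r1 r'')"
      if ag: "agree 2 r1 r2" and c: "c < 4" "r1 c = of_bool (Q i j)" for r2 c
    proof -
      have rd2: "ready n r2" "env 2 r2 = [i, j]" using agree_ready[OF ag] agree_env[OF ag] r1 by auto
      have c2: "r2 c = of_bool (Q i j)" "r2 zero_reg = 0"
        using ag c rd2(1) by (auto simp: agree_def protected_def ready_def)
      show ?thesis
        by (rule runs_weaken[OF runs_write_prog[OF rd2 ij(1) _ c(1)] order_refl])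
           (use J' ag c2 in \<open>auto intro: agree_trans\<close>)
    qed
    have "runs (output_body \<psi>) (r1, m1) (poly (check_time \<psi>) n + (1 + ((3 * n + 5) + (3 * n + 5))))
       (\<lambda>(r'', m''). J (insert (i, j) S) m'' \<and> agree 2 r1 r'')"
      unfolding output_body_def
    proof (rule runs_Seq, rule runs_weaken[OF runs_compile[OF wf r1(1) v1] order_refl])
      fix s2 assume "(\<lambda>(r', m'). m' = m1 \<and> (r' res_reg \<noteq> 0 \<longleftrightarrow> holds n m1 (env 2 r1) \<psi>) \<and> agree 2 r1 r') s2"
      then obtain r2 where s2: "s2 = (r2, m1)" and r2: "r2 res_reg \<noteq> 0 \<longleftrightarrow> Q i j" "agree 2 r1 r2"
        using ev by (cases s2) auto
      show "runs (IfNZ res_reg (write_prog zero_reg one_reg) (write_prog zero_reg zero_reg)) s2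
          (1 + ((3 * n + 5) + (3 * n + 5))) (\<lambda>(r'', m''). J (insert (i, j) S) m'' \<and> agree 2 r1 r'')"
        unfolding s2 by (rule runs_IfNZ; rule w[OF r2(2)]) (use r1(1) r2(1) in \<open>auto simp: ready_def\<close>)
    qed
    then show "runs (output_body \<psi>) (r1, m1) (6 * n + poly (check_time \<psi>) n + 11)
       (\<lambda>(r'', m''). J (insert (i, j) S) m'' \<and> agree 2 r1 r'')"
      by (rule runs_weaken) auto
  qed
  then show ?thesis by (rule runs_weaken) (auto simp: J_def)
qed

definition greedy_time :: "fm \<Rightarrow> fm \<Rightarrow> nat poly" where
  "greedy_time \<phi> \<psi> = [:3, 6:] +
     ([:0, 1:] * ([:0, 1:] * (check_time \<phi> + [:15, 6:]) + [:5:]) + [:2:]) +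
     ([:0, 1:] * ([:0, 1:] * (check_time \<psi> + [:14, 6:]) + [:5:]) + [:2:])"

text \<open>
  Any upward closed \<open>P\<close> on sets of cells that is definable by a formula has an inclusion-minimal
  member that is found in polynomial time. The assignment \<open>[i, j]\<close> comes from the two enclosing loops; \<open>\<phi>\<close>
  is tested at depth \<open>2\<close>, but its truth must not depend on \<open>i\<close> and \<open>j\<close>, while \<open>\<psi>\<close> defines the output entry
  at \<open>(i, j)\<close>.
\<close>

theorem runs_greedy_prog:
  assumes wf: "wf_fm 2 \<phi>" "wf_fm 2 \<psi>" and x: "length x = n * n"
    and P: "\<And>D i j. D \<subseteq> cells n \<Longrightarrow> i < n \<Longrightarrow> j < n \<Longrightarrow>
      holds n (graph_mem n x D) [i, j] \<phi> \<longleftrightarrow> P D"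
    and mono: "\<And>D D'. P D \<Longrightarrow> D \<subseteq> D' \<Longrightarrow> D' \<subseteq> cells n \<Longrightarrow> P D'"
    and full: "P (cells n)"
    and Q: "\<And>D m i j. D \<subseteq> cells n \<Longrightarrow>
      (\<And>k l. k < n \<Longrightarrow> l < n \<Longrightarrow> m (n * n + k * n + l) = of_bool ((k, l) \<notin> D)) \<Longrightarrow>
      i < n \<Longrightarrow> j < n \<Longrightarrow> holds n m [i, j] \<psi> \<longleftrightarrow> Q D i j"
  shows "runs (greedy_prog \<phi> \<psi>) (input_state x) (poly (greedy_time \<phi> \<psi>) n)
    (\<lambda>(r, m). ready n r \<and> (\<exists>D\<subseteq>cells n. P D \<and> (\<forall>c\<in>D. \<not> P (D - {c})) \<and>
       (\<forall>i<n. \<forall>j<n. m (i * n + j) = of_bool (Q D i j))))"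
    (is "runs _ _ _ ?R")
proof -
  have "runs (greedy_prog \<phi> \<psi>) (input_state x) ((6 * n + 3) +
      ((n * (n * ((6 * n + poly (check_time \<phi>) n + 12) + 3) + 2 + 3) + 2) +
       (n * (n * ((6 * n + poly (check_time \<psi>) n + 11) + 3) + 2 + 3) + 2))) ?R"
    unfolding greedy_prog_def
  proof (rule runs_Seq, rule runs_weaken[OF runs_sqrt_prog[OF x] order_refl])
    fix s1 assume "(\<lambda>(r, m). ready n r \<and> m = graph_mem n x (cells n)) s1"
    then obtain r1 where s1: "s1 = (r1, graph_mem n x (cells n))" and r1: "ready n r1" by (cases s1) auto
    show "runs (for_prog 0 (for_prog 1 (greedy_body \<phi>)) ;; for_prog 0 (for_prog 1 (output_body \<psi>))) s1
      ((n * (n * ((6 * n + poly (check_time \<phi>) n + 12) + 3) + 2 + 3) + 2) +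
       (n * (n * ((6 * n + poly (check_time \<psi>) n + 11) + 3) + 2 + 3) + 2)) ?R"
      unfolding s1
    proof (rule runs_Seq, rule runs_weaken[OF runs_greedy_loop[OF r1 wf(1) P mono full] order_refl])
      fix s2 assume s2: "(\<lambda>(r', m'). (\<exists>D\<subseteq>cells n. m' = graph_mem n x D \<and> P D \<and>
        (\<forall>c\<in>D. \<not> P (D - {c}))) \<and> ready n r') s2"
      obtain r2 m2 where "s2 = (r2, m2)" by (cases s2)
      with s2 obtain D where D: "D \<subseteq> cells n" "s2 = (r2, graph_mem n x D)" "P D"
        "\<forall>c\<in>D. \<not> P (D - {c})" and r2: "ready n r2" by auto
      show "runs (for_prog 0 (for_prog 1 (output_body \<psi>))) s2
         (n * (n * ((6 * n + poly (check_time \<psi>) n + 11) + 3) + 2 + 3) + 2) ?R"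
        unfolding D(2)
        by (rule runs_weaken[OF runs_output_loop[OF r2 wf(2) Q[OF D(1)]] order_refl])
           (use D in auto)
    qed
  qed
  then show ?thesis
    by (rule runs_weaken) (auto simp: greedy_time_def algebra_simps)
qed

lemma poly_mono_nat: "m \<le> n \<Longrightarrow> poly p m \<le> poly p (n :: nat)"
  by (induction p) (auto intro!: add_mono mult_mono)

section \<open>Codes in first-order logic\<close>

abbreviation Disj :: "fm \<Rightarrow> fm \<Rightarrow> fm" where "Disj \<phi> \<psi> \<equiv> Neg (Conj (Neg \<phi>) (Neg \<psi>))"
abbreviation Imp :: "fm \<Rightarrow> fm \<Rightarrow> fm" where "Imp \<phi> \<psi> \<equiv> Neg (Conj \<phi> (Neg \<psi>))"
abbreviation Xor :: "fm \<Rightarrow> fm \<Rightarrow> fm" where "Xor \<phi> \<psi> \<equiv> Conj (Disj \<phi> \<psi>) (Neg (Conj \<phi> \<psi>))"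
abbreviation Forall :: "fm \<Rightarrow> fm" where "Forall \<phi> \<equiv> Neg (Exists (Neg \<phi>))"
abbreviation Kept :: "nat \<Rightarrow> nat \<Rightarrow> fm" where "Kept x y \<equiv> Neg (Removed x y)"

definition Eq :: "nat \<Rightarrow> nat \<Rightarrow> fm" where
  "Eq x y = Conj (Neg (Less x y)) (Neg (Less y x))"

lemma holds_Eq [simp]: "holds n m \<sigma> (Eq x y) \<longleftrightarrow> \<sigma> ! x = \<sigma> ! y"
  by (auto simp: Eq_def)

lemma wf_Eq [simp]: "wf_fm d (Eq x y) \<longleftrightarrow> x < d \<and> y < d"
  by (auto simp: Eq_def)

definition touches :: "'a set \<Rightarrow> 'a set \<Rightarrow> bool" where
  "touches e f \<longleftrightarrow> e \<inter> f \<noteq> {}"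

definition meet_fm :: "nat \<Rightarrow> nat \<Rightarrow> nat \<Rightarrow> nat \<Rightarrow> fm" where
  "meet_fm i j k l = Disj (Disj (Eq k i) (Eq k j)) (Disj (Eq l i) (Eq l j))"

definition same_fm :: "nat \<Rightarrow> nat \<Rightarrow> nat \<Rightarrow> nat \<Rightarrow> fm" where
  "same_fm i j k l = Disj (Conj (Eq i k) (Eq j l)) (Conj (Eq i l) (Eq j k))"

lemma holds_meet_fm:
  "holds n m \<sigma> (meet_fm i j k l) \<longleftrightarrow> touches {\<sigma> ! k, \<sigma> ! l} {\<sigma> ! i, \<sigma> ! j}"
  by (auto simp: meet_fm_def touches_def)

lemma holds_same_fm:
  "holds n m \<sigma> (same_fm i j k l) \<longleftrightarrow> {\<sigma> ! i, \<sigma> ! j} = {\<sigma> ! k, \<sigma> ! l}"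
  by (auto simp: same_fm_def doubleton_eq_iff)

text \<open>
  The cell \<open>(k, l)\<close> stands for the edge with ends \<open>k\<close> and \<open>l\<close>. The two cells of an edge have the same effect, so
  a minimal set of cells contains at most one of them, and the output is symmetrized. The first
  conjunct is domination, the second separation.
\<close>

definition edge_code_fm :: fm where
  "edge_code_fm = Conj
     (Forall (Forall (Imp (Input 2 3) (Exists (Exists (Conj (Kept 4 5) (Conj (Input 4 5) (meet_fm 2 3 4 5))))))))
     (Forall (Forall (Forall (Forall (Imp (Conj (Input 2 3) (Conj (Input 4 5) (Neg (same_fm 2 3 4 5))))
        (Exists (Exists (Conj (Kept 6 7) (Conj (Input 6 7)
          (Xor (meet_fm 2 3 6 7) (meet_fm 4 5 6 7)))))))))))"

definition edge_output_fm :: fm where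
  "edge_output_fm = Disj (Kept 0 1) (Kept 1 0)"

definition nbhd_fm :: "nat \<Rightarrow> nat \<Rightarrow> fm" where
  "nbhd_fm u w = Disj (Eq w u) (Input w u)"

text \<open>
  The cell \<open>(k, l)\<close> stands for the vertex \<open>l\<close>, so that sets of vertices are also represented by sets of cells.
  Every row of the output matrix is then the characteristic vector of the code; the first row
  is the required output.
\<close>

definition code_fm :: fm where
  "code_fm = Conj
     (Forall (Exists (Exists (Conj (Kept 3 4) (nbhd_fm 2 4)))))
     (Forall (Forall (Imp (Neg (Eq 2 3)) (Exists (Exists (Conj (Kept 4 5) (Xor (nbhd_fm 2 5) (nbhd_fm 3 5))))))))"

definition output_fm :: fm where
  "output_fm = Exists (Kept 2 1)"

lemma wf_fms [simp]:
  "wf_fm 2 edge_code_fm" "wf_fm 2 edge_output_fm" "wf_fm 2 code_fm" "wf_fm 2 output_fm"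
  by (simp_all add: edge_code_fm_def edge_output_fm_def code_fm_def output_fm_def
      nbhd_fm_def meet_fm_def same_fm_def)

lemma nth_concat_rows:
  assumes "i < k" "j < n"
  shows "concat (map (\<lambda>i. map (f i) [0..<n]) [0..<k]) ! (i * n + j) = f i j"
  using assms(1)
proof (induction k)
  case (Suc k)
  have len: "length (concat (map (\<lambda>i. map (f i) [0..<n]) [0..<k])) = k * n"
    by (simp add: length_concat comp_def sum_list_triv)
  show ?case
  proof (cases "i = k")
    case True
    then show ?thesis using assms(2) len by (simp add: nth_append)
  next
    case False
    then have "i < k" using Suc.prems by simp
    moreover have "i * n + j < k * n" using \<open>i < k\<close> assms(2) by (rule cell_less)
    ultimately show ?thesis using Suc.IH len by (simp add: nth_append)
  qed
qed simp

lemma encode_edge_set: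
  assumes "card (verts G) = n"
  shows "length (encode_edge_set G C) = n * n"
    and "i < n \<Longrightarrow> j < n \<Longrightarrow> encode_edge_set G C ! (i * n + j) \<longleftrightarrow> {i, j} \<in> C"
  using assms nth_concat_rows[of i n j n "\<lambda>i j. {i, j} \<in> C"]
  by (simp_all add: encode_edge_set_def length_concat comp_def sum_list_triv)

text \<open>
  By minimality, no cell represents something outside \<open>X\<close> and no two cells represent the same
  element; so a minimal set of cells represents a minimal code.
\<close>

lemma minimal_image:
  assumes P: "P (h ` D \<inter> X)" and min: "\<And>c. c \<in> D \<Longrightarrow> \<not> P (h ` (D - {c}) \<inter> X)"
  shows "h ` D \<subseteq> X" "b \<in> h ` D \<Longrightarrow> \<not> P (h ` D - {b})"
proof -
  have ins: "h ` D = insert (h c) (h ` (D - {c}))" if "c \<in> D" for c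
    using that by (metis image_insert insert_Diff)
  have mem: "h c \<in> X" if "c \<in> D" for c
  proof (rule ccontr)
    assume "h c \<notin> X"
    then show False using min[OF that] P ins[OF that] by simp
  qed
  then show sub: "h ` D \<subseteq> X" by (rule image_subsetI)
  assume "b \<in> h ` D"
  then obtain c where c: "c \<in> D" "b = h c" by auto
  show "\<not> P (h ` D - {b})"
  proof (cases "h c \<in> h ` (D - {c})")
    case True
    then have "h ` (D - {c}) = h ` D" using ins[OF c(1)] by (simp add: insert_absorb)
    then show ?thesis using min[OF c(1)] P by simp
  next
    case False
    then have "h ` D - {b} = h ` (D - {c})" using ins[OF c(1)] c(2) by simp
    moreover have "h ` (D - {c}) \<inter> X = h ` (D - {c})" using mem by (intro Int_absorb2) auto
    ultimately show ?thesis using min[OF c(1)] by simp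
  qed
qed

definition cell_edge :: "nat \<times> nat \<Rightarrow> nat set" where
  "cell_edge c = {fst c, snd c}"

lemma all_edges_iff:
  assumes "simple_graph G" "verts G = {0..<n}"
  shows "(\<forall>e\<in>edges G. R e) \<longleftrightarrow> (\<forall>i<n. \<forall>j<n. {i, j} \<in> edges G \<longrightarrow> R {i, j})"
proof (intro iffI ballI)
  fix e assume R: "\<forall>i<n. \<forall>j<n. {i, j} \<in> edges G \<longrightarrow> R {i, j}" and e: "e \<in> edges G"
  have "e \<subseteq> {0..<n}" "card e = 2" using e assms by (auto simp: simple_graph_def)
  moreover from this(2) obtain i j where "e = {i, j}" by (auto simp: card_2_iff)
  ultimately show "R e" using R e by simp
qed simp

lemma trace_nonempty_iff: "trace C e \<noteq> {} \<longleftrightarrow> (\<exists>g\<in>C. touches g e)"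
  by (auto simp: trace_def touches_def)

lemma trace_neq_iff: "trace C e \<noteq> trace C f \<longleftrightarrow> (\<exists>g\<in>C. touches g e \<noteq> touches g f)"
proof -
  have "trace C e = trace C f \<longleftrightarrow> (\<forall>g\<in>C. touches g e = touches g f)"
    by (auto simp: set_eq_iff[of "trace C e"] touches_def)
  then show ?thesis by blast
qed

lemma holds_edge_code_fm:
  assumes G: "simple_graph G" and n: "verts G = {0..<n}" and D: "D \<subseteq> cells n"
  shows "holds n (graph_mem n (encode_graph G) D) [p, q] edge_code_fm \<longleftrightarrow>
    edge_identifying_code G (cell_edge ` D \<inter> edges G)"
proof -
  let ?m = "graph_mem n (encode_graph G) D" and ?C = "cell_edge ` D \<inter> edges G"
  have inp: "?m (i * n + j) \<noteq> 0 \<longleftrightarrow> {i, j} \<in> edges G" if "i < n" "j < n" for i j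
    using that encode_edge_set(2)[of G n i j "edges G"] n by (simp add: graph_mem_input encode_graph_def)
  have rem: "?m (n * n + i * n + j) \<noteq> 0 \<longleftrightarrow> (i, j) \<notin> D" if "i < n" "j < n" for i j
    using that by (simp add: graph_mem_removed)
  have ex: "(\<exists>g\<in>?C. R g) \<longleftrightarrow> (\<exists>k<n. \<exists>l<n. (k, l) \<in> D \<and> {k, l} \<in> edges G \<and> R {k, l})" for R
  proof -
    have "(\<exists>g\<in>?C. R g) \<longleftrightarrow> (\<exists>c\<in>D. cell_edge c \<in> edges G \<and> R (cell_edge c))" by blast
    also have "\<dots> \<longleftrightarrow> (\<exists>k l. (k, l) \<in> D \<and> {k, l} \<in> edges G \<and> R {k, l})"
      by (simp add: Bex_def cell_edge_def)
    also have "\<dots> \<longleftrightarrow> (\<exists>k<n. \<exists>l<n. (k, l) \<in> D \<and> {k, l} \<in> edges G \<and> R {k, l})"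
    proof -
      have "k < n \<and> l < n" if "(k, l) \<in> D" for k l using subsetD[OF D that] by simp
      then show ?thesis by blast
    qed
    finally show ?thesis .
  qed
  have dom: "trace ?C e \<noteq> {} \<longleftrightarrow>
      (\<exists>k<n. \<exists>l<n. (k, l) \<in> D \<and> {k, l} \<in> edges G \<and> touches {k, l} e)" for e
    unfolding trace_nonempty_iff ex ..
  have sep: "trace ?C e \<noteq> trace ?C f \<longleftrightarrow>
      (\<exists>k<n. \<exists>l<n. (k, l) \<in> D \<and> {k, l} \<in> edges G \<and> (touches {k, l} e) \<noteq> (touches {k, l} f))" for e f
    unfolding trace_neq_iff ex ..
  have "edge_identifying_code G ?C \<longleftrightarrow>
    (\<forall>i<n. \<forall>j<n. {i, j} \<in> edges G \<longrightarrow>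
      (\<exists>k<n. \<exists>l<n. (k, l) \<in> D \<and> {k, l} \<in> edges G \<and> touches {k, l} {i, j})) \<and>
    (\<forall>i<n. \<forall>j<n. {i, j} \<in> edges G \<longrightarrow> (\<forall>i'<n. \<forall>j'<n. {i', j'} \<in> edges G \<longrightarrow>
      {i, j} \<noteq> {i', j'} \<longrightarrow> (\<exists>k<n. \<exists>l<n. (k, l) \<in> D \<and> {k, l} \<in> edges G \<and>
        (touches {k, l} {i, j}) \<noteq> (touches {k, l} {i', j'}))))"
    unfolding edge_identifying_code_iff_trace[OF G] all_edges_iff[OF G n] dom sep by simp
  also have "\<dots> \<longleftrightarrow> holds n ?m [p, q] edge_code_fm"
    unfolding edge_code_fm_def
    by (simp add: holds_meet_fm holds_same_fm inp[simplified] rem[simplified] cong: conj_cong)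
       (intro arg_cong2[of _ _ _ _ "(\<and>)"] all_cong1 imp_cong refl; blast)
  finally show ?thesis by simp
qed

lemma holds_code_fm:
  assumes n: "verts H = {0..<n}" and D: "D \<subseteq> cells n"
  shows "holds n (graph_mem n (encode_graph H) D) [p, q] code_fm \<longleftrightarrow>
    identifying_code H (snd ` D \<inter> verts H)"
proof -
  let ?m = "graph_mem n (encode_graph H) D" and ?C = "snd ` D \<inter> verts H"
  have inp: "?m (i * n + j) \<noteq> 0 \<longleftrightarrow> {i, j} \<in> edges H" if "i < n" "j < n" for i j
    using that encode_edge_set(2)[of H n i j "edges H"] n by (simp add: graph_mem_input encode_graph_def)
  have rem: "?m (n * n + i * n + j) \<noteq> 0 \<longleftrightarrow> (i, j) \<notin> D" if "i < n" "j < n" for i j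
    using that by (simp add: graph_mem_removed)
  have C: "w \<in> ?C \<longleftrightarrow> w < n \<and> (\<exists>i<n. (i, w) \<in> D)" for w
  proof -
    have "i < n \<and> w < n" if "(i, w) \<in> D" for i using subsetD[OF D that] by simp
    then show ?thesis using n by force
  qed
  have dom: "closed_nbhd H v \<inter> ?C \<noteq> {} \<longleftrightarrow>
      (\<exists>i<n. \<exists>w<n. (i, w) \<in> D \<and> (w = v \<or> {w, v} \<in> edges H))" for v
  proof -
    have "closed_nbhd H v \<inter> ?C \<noteq> {} \<longleftrightarrow> (\<exists>w. w \<in> ?C \<and> (w = v \<or> {w, v} \<in> edges H))"
      unfolding closed_nbhd_def by blast
    then show ?thesis unfolding C by blast
  qed
  have sep: "closed_nbhd H u \<inter> ?C \<noteq> closed_nbhd H v \<inter> ?C \<longleftrightarrow>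
      (\<exists>i<n. \<exists>w<n. (i, w) \<in> D \<and> (w = u \<or> {w, u} \<in> edges H) \<noteq> (w = v \<or> {w, v} \<in> edges H))" for u v
  proof -
    have "closed_nbhd H u \<inter> ?C \<noteq> closed_nbhd H v \<inter> ?C \<longleftrightarrow>
      (\<exists>w. w \<in> ?C \<and> (w = u \<or> {w, u} \<in> edges H) \<noteq> (w = v \<or> {w, v} \<in> edges H))"
      unfolding closed_nbhd_def set_eq_iff by blast
    then show ?thesis unfolding C by blast
  qed
  have "identifying_code H ?C \<longleftrightarrow>
    (\<forall>v<n. \<exists>i<n. \<exists>w<n. (i, w) \<in> D \<and> (w = v \<or> {w, v} \<in> edges H)) \<and>
    (\<forall>u<n. \<forall>v<n. u \<noteq> v \<longrightarrow> (\<exists>i<n. \<exists>w<n. (i, w) \<in> D \<and>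
      (w = u \<or> {w, u} \<in> edges H) \<noteq> (w = v \<or> {w, v} \<in> edges H)))"
    unfolding identifying_code_def dom sep using n by (simp add: Ball_def)
  also have "\<dots> \<longleftrightarrow> holds n ?m [p, q] code_fm"
    unfolding code_fm_def nbhd_fm_def
    by (simp add: inp[simplified] rem[simplified] cong: conj_cong)
       (intro arg_cong2[of _ _ _ _ "(\<and>)"] all_cong1 imp_cong refl; blast)
  finally show ?thesis by simp
qed

section \<open>Approximation\<close>

lemma edge_code_approximable:
  assumes G: "std_graph G" and pf: "pendant_free G"
  shows "\<exists>C. outputs_within (greedy_prog edge_code_fm edge_output_fm) (encode_graph G)
      (poly (greedy_time edge_code_fm edge_output_fm) (length (encode_graph G))) (encode_edge_set G C) \<and>
    edge_identifying_code G C \<and> card C \<le> 4 * gamma_EID G"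
proof -
  obtain n where sg: "simple_graph G" and n: "verts G = {0..<n}" using G by (auto simp: std_graph_def)
  let ?x = "encode_graph G"
  have cn: "card (verts G) = n" using n by simp
  have len: "length ?x = n * n" using encode_edge_set(1)[OF cn] by (simp add: encode_graph_def)
  let ?P = "\<lambda>D. edge_identifying_code G (cell_edge ` D \<inter> edges G)"
  let ?Q = "\<lambda>D i j. {i, j} \<in> cell_edge ` D"
  have full: "?P (cells n)"
  proof -
    have "edges G \<subseteq> cell_edge ` cells n"
      using all_edges_iff[OF sg n, of "\<lambda>e. e \<in> cell_edge ` cells n"]
      by (auto simp: cell_edge_def image_iff Bex_def)
    then show ?thesis using pendant_free_code[OF sg pf] by (simp add: Int_absorb1)
  qed
  have "runs (greedy_prog edge_code_fm edge_output_fm) (input_state ?x)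
    (poly (greedy_time edge_code_fm edge_output_fm) n)
    (\<lambda>(r, m). ready n r \<and> (\<exists>D\<subseteq>cells n. ?P D \<and> (\<forall>c\<in>D. \<not> ?P (D - {c})) \<and>
       (\<forall>i<n. \<forall>j<n. m (i * n + j) = of_bool (?Q D i j))))"
  proof (rule runs_greedy_prog[OF wf_fms(1,2) len])
    show "?P D'" if "?P D" "D \<subseteq> D'" for D D' :: "(nat \<times> nat) set"
      using that(1) by (rule edge_identifying_code_mono) (use that(2) in auto)
    show "holds n m [i, j] edge_output_fm \<longleftrightarrow> ?Q D i j"
      if "\<And>k l. k < n \<Longrightarrow> l < n \<Longrightarrow> m (n * n + k * n + l) = of_bool ((k, l) \<notin> D)" "i < n" "j < n"
      for D and m :: "nat \<Rightarrow> nat" and i j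
    proof -
      have "?Q D i j \<longleftrightarrow> (i, j) \<in> D \<or> (j, i) \<in> D"
        by (force simp: cell_edge_def image_iff doubleton_eq_iff Bex_def)
      then show ?thesis using that by (simp add: edge_output_fm_def)
    qed
  qed (use full holds_edge_code_fm[OF sg n] in auto)
  then obtain t r m D where ex: "exec (greedy_prog edge_code_fm edge_output_fm) (input_state ?x) t (r, m)"
    "t \<le> poly (greedy_time edge_code_fm edge_output_fm) n" and r: "ready n r" and
    D: "?P D" "\<And>c. c \<in> D \<Longrightarrow> \<not> ?P (D - {c})" and
    m: "\<And>i j. i < n \<Longrightarrow> j < n \<Longrightarrow> m (i * n + j) = of_bool (?Q D i j)"
    unfolding runs_def by auto
  let ?C = "cell_edge ` D"
  note min = minimal_image[of "edge_identifying_code G" cell_edge D "edges G", OF D]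
  have C: "edge_identifying_code G ?C" using D(1) min(1) by (simp add: Int_absorb2)
  obtain C' where C': "edge_identifying_code G C'" "card C' = gamma_EID G"
    using gamma_EID_witness[OF C] .
  have "card ?C \<le> 4 * gamma_EID G"
    using minimal_code_approximates[OF sg C min(2) C'(1)] C'(2) by simp
  moreover have "holds_output (r, m) (encode_edge_set G ?C)"
    unfolding holds_output_def
  proof (intro conjI allI impI)
    show "fst (r, m) 0 = length (encode_edge_set G ?C)"
      using r encode_edge_set(1)[OF cn] by (simp add: ready_def)
    fix a assume "a < length (encode_edge_set G ?C)"
    then have a: "a < n * n" using encode_edge_set(1)[OF cn] by simp
    then have "n > 0" by (cases n) auto
    then have ij: "a div n < n" "a mod n < n" "a div n * n + a mod n = a"
      using a by (simp_all add: less_mult_imp_div_less)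
    show "snd (r, m) a = of_bool (encode_edge_set G ?C ! a)"
      using m[OF ij(1,2)] encode_edge_set(2)[OF cn ij(1,2)] ij(3) by simp
  qed
  moreover have "poly (greedy_time edge_code_fm edge_output_fm) n \<le>
      poly (greedy_time edge_code_fm edge_output_fm) (length ?x)"
    unfolding len by (rule poly_mono_nat) (rule le_square)
  ultimately show ?thesis using ex C unfolding outputs_within_def by (meson le_trans)
qed

text \<open>
  The additional instruction sets the output length to \<open>n\<close>, which cuts the output matrix down to its first row.
\<close>

lemma line_graph_code_approximable:
  assumes H: "std_graph H" and line: "is_line_graph H" and tf: "twin_free H"
  shows "\<exists>C. outputs_within (greedy_prog code_fm output_fm ;; Add len_reg size_reg zero_reg) (encode_graph H)
      (poly (greedy_time code_fm output_fm + [:1:]) (length (encode_graph H))) (encode_vertex_set H C) \<and>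
    identifying_code H C \<and> card C \<le> 4 * gamma_ID H"
proof -
  obtain n where n: "verts H = {0..<n}" using H by (auto simp: std_graph_def)
  let ?x = "encode_graph H"
  have cn: "card (verts H) = n" using n by simp
  have len: "length ?x = n * n" using encode_edge_set(1)[OF cn] by (simp add: encode_graph_def)
  let ?P = "\<lambda>D. identifying_code H (snd ` D \<inter> verts H)"
  let ?Q = "\<lambda>D i j. j \<in> snd ` D"
  have full: "?P (cells n)"
  proof -
    have "verts H \<subseteq> snd ` cells n" using n by (force simp: cells_def)
    then show ?thesis using twin_free_code[OF tf] by (simp add: Int_absorb1)
  qed
  have "runs (greedy_prog code_fm output_fm) (input_state ?x) (poly (greedy_time code_fm output_fm) n)
    (\<lambda>(r, m). ready n r \<and> (\<exists>D\<subseteq>cells n. ?P D \<and> (\<forall>c\<in>D. \<not> ?P (D - {c})) \<and>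
       (\<forall>i<n. \<forall>j<n. m (i * n + j) = of_bool (?Q D i j))))"
  proof (rule runs_greedy_prog[OF wf_fms(3,4) len])
    show "?P D'" if "?P D" "D \<subseteq> D'" for D D' :: "(nat \<times> nat) set"
      using that(1) by (rule identifying_code_mono) (use that(2) in auto)
    show "holds n m [i, j] output_fm \<longleftrightarrow> ?Q D i j"
      if D: "D \<subseteq> cells n"
        and m: "\<And>k l. k < n \<Longrightarrow> l < n \<Longrightarrow> m (n * n + k * n + l) = of_bool ((k, l) \<notin> D)"
        and ij: "i < n" "j < n"
      for D and m :: "nat \<Rightarrow> nat" and i j
    proof -
      have "k < n" if "(k, j) \<in> D" for k using subsetD[OF D that] by simp
      then have "?Q D i j \<longleftrightarrow> (\<exists>k<n. (k, j) \<in> D)" by force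
      then show ?thesis using m ij by (simp add: output_fm_def cong: conj_cong)
    qed
  qed (use full holds_code_fm[OF n] in auto)
  then obtain t r m D where ex: "exec (greedy_prog code_fm output_fm) (input_state ?x) t (r, m)"
    "t \<le> poly (greedy_time code_fm output_fm) n" and r: "ready n r" and
    D: "D \<subseteq> cells n" "?P D" "\<And>c. c \<in> D \<Longrightarrow> \<not> ?P (D - {c})" and
    m: "\<And>i j. i < n \<Longrightarrow> j < n \<Longrightarrow> m (i * n + j) = of_bool (?Q D i j)"
    unfolding runs_def by auto
  let ?C = "snd ` D"
  note min = minimal_image[of "identifying_code H" snd D "verts H", OF D(2,3)]
  have C: "identifying_code H ?C" using D(2) min(1) by (simp add: Int_absorb2)
  obtain C' where C': "identifying_code H C'" "card C' = gamma_ID H"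
    using gamma_ID_witness[OF C] .
  have "card ?C \<le> 4 * gamma_ID H"
    using minimal_line_graph_code_approximates[OF line C min(2) C'(1)] C'(2) by simp
  moreover have "exec (greedy_prog code_fm output_fm ;; Add len_reg size_reg zero_reg)
      (input_state ?x) (t + 1) (r(len_reg := r size_reg + r zero_reg), m)"
    using ex(1) by (rule exec.Seq) (rule exec.Add)
  moreover have "holds_output (r(len_reg := r size_reg + r zero_reg), m) (encode_vertex_set H ?C)"
    unfolding holds_output_def using m[of 0] r cn by (auto simp: encode_vertex_set_def ready_def)
  moreover have "t + 1 \<le> poly (greedy_time code_fm output_fm + [:1:]) (length ?x)"
    using ex(2) poly_mono_nat[OF le_square, of "greedy_time code_fm output_fm" n] unfolding len by simp
  ultimately show ?thesis using C unfolding outputs_within_def by blast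
qed

theorem theorem24:
  shows "(\<exists>(A :: com) (p :: nat poly). \<forall>G :: nat ugraph.
            std_graph G \<and> edges G \<noteq> {} \<and> pendant_free G \<longrightarrow>
            (\<exists>C. outputs_within A (encode_graph G) (poly p (length (encode_graph G)))
                   (encode_edge_set G C) \<and>
                 edge_identifying_code G C \<and> card C \<le> 4 * gamma_EID G))
       \<and> (\<exists>(A :: com) (p :: nat poly). \<forall>H :: nat ugraph.
            std_graph H \<and> is_line_graph H \<and> twin_free H \<longrightarrow>
            (\<exists>C. outputs_within A (encode_graph H) (poly p (length (encode_graph H)))
                   (encode_vertex_set H C) \<and>
                 identifying_code H C \<and> card C \<le> 4 * gamma_ID H))"
  using edge_code_approximable line_graph_code_approximable by blast

end
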